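(* A universe $\mathcal U$ is univalent if and only if, for all $A,B:\mathcal U$ and $f:A\to B$, there is a map $\operatorname{isEquiv}(f)\to\operatorname{isPIE}_{A,B}(f)$.
   Context: Martin-Löf type theory with a universe $\mathcal U$ (no extensionality axioms assumed). $\operatorname{idtofun}:(A=B)\to(A\to B)$ is defined by path induction with $\operatorname{idtofun}(\mathrm{refl}_A)=\mathrm{id}_A$, and $\operatorname{idtoequiv}:(A=B)\to(A\simeq B)$ similarly. $\operatorname{isEquiv}(f):=\big(\sum_{g:B\to A}g\circ f\sim\mathrm{id}_A\big)\times\big(\sum_{h:B\to A}f\circ h\sim\mathrm{id}_B\big)$, where $\sim$ is pointwise equality, and $A\simeq B:=\sum_{f:A\to B}\operatorname{isEquiv}(f)$. A path-induced equivalence structure on $f:A\to B$ is $\operatorname{isPIE}_{A,B}(f):=\sum_{p:A=B}f=\operatorname{idtofun}(p)$. $\mathcal U$ is univalent if $\operatorname{idtoequiv}_{A,B}$ is an equivalence for all $A,B:\mathcal U$. *)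

theory Defs
  imports Main
begin

text \<open>
  Intensional Martin-Loef type theory with \<open>\<Pi>\<close>-, \<open>\<Sigma>\<close>- and identity types and a universe \<open>\<U>\<close>
  (a la Russell) closed under these type formers, presented by typed judgements over raw terms with
  de Bruijn indices. As usual in homotopy type theory, \<open>\<eta>\<close> for functions is a judgemental equality,
  whereas \<open>\<Sigma>\<close> and identity types only have their eliminators and computation rules. There are no
  extensionality principles: no equality reflection, no K, no function extensionality.
\<close>

text \<open>
  Binding structure: \<open>B\<close> in \<open>Pi A B\<close>, \<open>Sig A B\<close>, \<open>Pair A B a b\<close>, \<open>SigInd A B C g p\<close> and \<open>b\<close> in
  \<open>Lam A b\<close> bind one variable of type \<open>A\<close>. In \<open>SigInd A B C g p\<close>, \<open>C\<close> binds one variable (of type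
  \<open>Sig A B\<close>) and \<open>g\<close> binds two, index 1 of type \<open>A\<close> and index 0 of type \<open>B\<close>. In the path induction
  term \<open>J A a C d b p\<close>, with \<open>p\<close> a path from \<open>a\<close> to \<open>b\<close> in \<open>A\<close>, the motive \<open>C\<close> binds two: index 1
  is the endpoint \<open>y\<close> in \<open>A\<close> and index 0 is the path from \<open>a\<close> to \<open>y\<close>.
\<close>

datatype tm =
    Var nat
  | \<U>
  | Pi tm tm
  | Lam tm tm
  | App tm tm
  | Sig tm tm
  | Pair tm tm tm tm
  | SigInd tm tm tm tm tm
  | Id tm tm tm
  | Refl tm tm
  | J tm tm tm tm tm tm

definition up_ren :: "(nat \<Rightarrow> nat) \<Rightarrow> nat \<Rightarrow> nat" where
  "up_ren r n = (case n of 0 \<Rightarrow> 0 | Suc m \<Rightarrow> Suc (r m))"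

primrec ren :: "(nat \<Rightarrow> nat) \<Rightarrow> tm \<Rightarrow> tm" where
  "ren r (Var n) = Var (r n)"
| "ren r \<U> = \<U>"
| "ren r (Pi A B) = Pi (ren r A) (ren (up_ren r) B)"
| "ren r (Lam A b) = Lam (ren r A) (ren (up_ren r) b)"
| "ren r (App f a) = App (ren r f) (ren r a)"
| "ren r (Sig A B) = Sig (ren r A) (ren (up_ren r) B)"
| "ren r (Pair A B a b) = Pair (ren r A) (ren (up_ren r) B) (ren r a) (ren r b)"
| "ren r (SigInd A B C g p) =
     SigInd (ren r A) (ren (up_ren r) B) (ren (up_ren r) C) (ren (up_ren (up_ren r)) g) (ren r p)"
| "ren r (Id A a b) = Id (ren r A) (ren r a) (ren r b)"
| "ren r (Refl A a) = Refl (ren r A) (ren r a)"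
| "ren r (J A a C d b p) =
     J (ren r A) (ren r a) (ren (up_ren (up_ren r)) C) (ren r d) (ren r b) (ren r p)"

abbreviation wk :: "tm \<Rightarrow> tm" where
  "wk \<equiv> ren Suc"

definition cons_sub :: "tm \<Rightarrow> (nat \<Rightarrow> tm) \<Rightarrow> nat \<Rightarrow> tm" where
  "cons_sub a s n = (case n of 0 \<Rightarrow> a | Suc m \<Rightarrow> s m)"

definition up_sub :: "(nat \<Rightarrow> tm) \<Rightarrow> nat \<Rightarrow> tm" where
  "up_sub s = cons_sub (Var 0) (\<lambda>n. wk (s n))"

primrec sub :: "(nat \<Rightarrow> tm) \<Rightarrow> tm \<Rightarrow> tm" where
  "sub s (Var n) = s n"
| "sub s \<U> = \<U>"
| "sub s (Pi A B) = Pi (sub s A) (sub (up_sub s) B)"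
| "sub s (Lam A b) = Lam (sub s A) (sub (up_sub s) b)"
| "sub s (App f a) = App (sub s f) (sub s a)"
| "sub s (Sig A B) = Sig (sub s A) (sub (up_sub s) B)"
| "sub s (Pair A B a b) = Pair (sub s A) (sub (up_sub s) B) (sub s a) (sub s b)"
| "sub s (SigInd A B C g p) =
     SigInd (sub s A) (sub (up_sub s) B) (sub (up_sub s) C) (sub (up_sub (up_sub s)) g) (sub s p)"
| "sub s (Id A a b) = Id (sub s A) (sub s a) (sub s b)"
| "sub s (Refl A a) = Refl (sub s A) (sub s a)"
| "sub s (J A a C d b p) =
     J (sub s A) (sub s a) (sub (up_sub (up_sub s)) C) (sub s d) (sub s b) (sub s p)"

definition inst :: "tm \<Rightarrow> tm \<Rightarrow> tm" where
  "inst B a = sub (cons_sub a Var) B"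

text \<open>\<open>inst2 C a b\<close> replaces index 1 by \<open>a\<close> and index 0 by \<open>b\<close>.\<close>

definition inst2 :: "tm \<Rightarrow> tm \<Rightarrow> tm \<Rightarrow> tm" where
  "inst2 C a b = sub (cons_sub b (cons_sub a Var)) C"

text \<open>For \<open>C\<close> over a variable \<open>z\<close> of type \<open>Sig A B\<close>, the type \<open>C[(x, y)/z]\<close> over \<open>x\<close> in \<open>A\<close>, \<open>y\<close> in \<open>B\<close>.\<close>

definition pair_inst :: "tm \<Rightarrow> tm \<Rightarrow> tm \<Rightarrow> tm" where
  "pair_inst A B C =
     sub (cons_sub (Pair (wk (wk A)) (ren (up_ren (\<lambda>n. n + 2)) B) (Var 1) (Var 0))
           (\<lambda>n. Var (n + 2))) C"

text \<open>The head of the list is the most recently declared variable.\<close>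

type_synonym ctx = "tm list"

inductive
  wf_ctx :: "ctx \<Rightarrow> bool" and
  is_type :: "ctx \<Rightarrow> tm \<Rightarrow> bool" ("_ \<turnstile> _ \<^bold>t\<^bold>y\<^bold>p\<^bold>e" [50, 50] 50) and
  eq_type :: "ctx \<Rightarrow> tm \<Rightarrow> tm \<Rightarrow> bool" ("_ \<turnstile> _ \<doteq> _ \<^bold>t\<^bold>y\<^bold>p\<^bold>e" [50, 50, 50] 50) and
  has_type :: "ctx \<Rightarrow> tm \<Rightarrow> tm \<Rightarrow> bool" ("_ \<turnstile> _ \<^bold>: _" [50, 50, 50] 50) and
  eq_term :: "ctx \<Rightarrow> tm \<Rightarrow> tm \<Rightarrow> tm \<Rightarrow> bool" ("_ \<turnstile> _ \<doteq> _ \<^bold>: _" [50, 50, 50, 50] 50)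
where
  ctx_Nil: "wf_ctx []"
| ctx_Cons: "\<lbrakk>wf_ctx \<Gamma>; \<Gamma> \<turnstile> A \<^bold>t\<^bold>y\<^bold>p\<^bold>e\<rbrakk> \<Longrightarrow> wf_ctx (A # \<Gamma>)"

| ty_U: "wf_ctx \<Gamma> \<Longrightarrow> \<Gamma> \<turnstile> \<U> \<^bold>t\<^bold>y\<^bold>p\<^bold>e"
| ty_El: "\<Gamma> \<turnstile> A \<^bold>: \<U> \<Longrightarrow> \<Gamma> \<turnstile> A \<^bold>t\<^bold>y\<^bold>p\<^bold>e"
| ty_Pi: "\<lbrakk>\<Gamma> \<turnstile> A \<^bold>t\<^bold>y\<^bold>p\<^bold>e; A # \<Gamma> \<turnstile> B \<^bold>t\<^bold>y\<^bold>p\<^bold>e\<rbrakk> \<Longrightarrow> \<Gamma> \<turnstile> Pi A B \<^bold>t\<^bold>y\<^bold>p\<^bold>e"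
| ty_Sig: "\<lbrakk>\<Gamma> \<turnstile> A \<^bold>t\<^bold>y\<^bold>p\<^bold>e; A # \<Gamma> \<turnstile> B \<^bold>t\<^bold>y\<^bold>p\<^bold>e\<rbrakk> \<Longrightarrow> \<Gamma> \<turnstile> Sig A B \<^bold>t\<^bold>y\<^bold>p\<^bold>e"
| ty_Id: "\<lbrakk>\<Gamma> \<turnstile> A \<^bold>t\<^bold>y\<^bold>p\<^bold>e; \<Gamma> \<turnstile> a \<^bold>: A; \<Gamma> \<turnstile> b \<^bold>: A\<rbrakk> \<Longrightarrow> \<Gamma> \<turnstile> Id A a b \<^bold>t\<^bold>y\<^bold>p\<^bold>e"

| eqty_refl: "\<Gamma> \<turnstile> A \<^bold>t\<^bold>y\<^bold>p\<^bold>e \<Longrightarrow> \<Gamma> \<turnstile> A \<doteq> A \<^bold>t\<^bold>y\<^bold>p\<^bold>e"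
| eqty_sym: "\<Gamma> \<turnstile> A \<doteq> B \<^bold>t\<^bold>y\<^bold>p\<^bold>e \<Longrightarrow> \<Gamma> \<turnstile> B \<doteq> A \<^bold>t\<^bold>y\<^bold>p\<^bold>e"
| eqty_trans: "\<lbrakk>\<Gamma> \<turnstile> A \<doteq> B \<^bold>t\<^bold>y\<^bold>p\<^bold>e; \<Gamma> \<turnstile> B \<doteq> C \<^bold>t\<^bold>y\<^bold>p\<^bold>e\<rbrakk> \<Longrightarrow> \<Gamma> \<turnstile> A \<doteq> C \<^bold>t\<^bold>y\<^bold>p\<^bold>e"
| eqty_El: "\<Gamma> \<turnstile> A \<doteq> B \<^bold>: \<U> \<Longrightarrow> \<Gamma> \<turnstile> A \<doteq> B \<^bold>t\<^bold>y\<^bold>p\<^bold>e"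
| eqty_Pi: "\<lbrakk>\<Gamma> \<turnstile> A \<^bold>t\<^bold>y\<^bold>p\<^bold>e; \<Gamma> \<turnstile> A \<doteq> A' \<^bold>t\<^bold>y\<^bold>p\<^bold>e; A # \<Gamma> \<turnstile> B \<doteq> B' \<^bold>t\<^bold>y\<^bold>p\<^bold>e\<rbrakk>
    \<Longrightarrow> \<Gamma> \<turnstile> Pi A B \<doteq> Pi A' B' \<^bold>t\<^bold>y\<^bold>p\<^bold>e"
| eqty_Sig: "\<lbrakk>\<Gamma> \<turnstile> A \<^bold>t\<^bold>y\<^bold>p\<^bold>e; \<Gamma> \<turnstile> A \<doteq> A' \<^bold>t\<^bold>y\<^bold>p\<^bold>e; A # \<Gamma> \<turnstile> B \<doteq> B' \<^bold>t\<^bold>y\<^bold>p\<^bold>e\<rbrakk>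
    \<Longrightarrow> \<Gamma> \<turnstile> Sig A B \<doteq> Sig A' B' \<^bold>t\<^bold>y\<^bold>p\<^bold>e"
| eqty_Id: "\<lbrakk>\<Gamma> \<turnstile> A \<doteq> A' \<^bold>t\<^bold>y\<^bold>p\<^bold>e; \<Gamma> \<turnstile> a \<doteq> a' \<^bold>: A; \<Gamma> \<turnstile> b \<doteq> b' \<^bold>: A\<rbrakk>
    \<Longrightarrow> \<Gamma> \<turnstile> Id A a b \<doteq> Id A' a' b' \<^bold>t\<^bold>y\<^bold>p\<^bold>e"

| tm_Var: "\<lbrakk>wf_ctx \<Gamma>; n < length \<Gamma>\<rbrakk> \<Longrightarrow> \<Gamma> \<turnstile> Var n \<^bold>: ren (\<lambda>k. k + Suc n) (\<Gamma> ! n)"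
| tm_conv: "\<lbrakk>\<Gamma> \<turnstile> t \<^bold>: A; \<Gamma> \<turnstile> A \<doteq> B \<^bold>t\<^bold>y\<^bold>p\<^bold>e\<rbrakk> \<Longrightarrow> \<Gamma> \<turnstile> t \<^bold>: B"
| tm_Pi: "\<lbrakk>\<Gamma> \<turnstile> A \<^bold>: \<U>; A # \<Gamma> \<turnstile> B \<^bold>: \<U>\<rbrakk> \<Longrightarrow> \<Gamma> \<turnstile> Pi A B \<^bold>: \<U>"
| tm_Sig: "\<lbrakk>\<Gamma> \<turnstile> A \<^bold>: \<U>; A # \<Gamma> \<turnstile> B \<^bold>: \<U>\<rbrakk> \<Longrightarrow> \<Gamma> \<turnstile> Sig A B \<^bold>: \<U>"
| tm_Id: "\<lbrakk>\<Gamma> \<turnstile> A \<^bold>: \<U>; \<Gamma> \<turnstile> a \<^bold>: A; \<Gamma> \<turnstile> b \<^bold>: A\<rbrakk> \<Longrightarrow> \<Gamma> \<turnstile> Id A a b \<^bold>: \<U>"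
| tm_Lam: "\<lbrakk>\<Gamma> \<turnstile> A \<^bold>t\<^bold>y\<^bold>p\<^bold>e; A # \<Gamma> \<turnstile> b \<^bold>: B\<rbrakk> \<Longrightarrow> \<Gamma> \<turnstile> Lam A b \<^bold>: Pi A B"
| tm_App: "\<lbrakk>\<Gamma> \<turnstile> f \<^bold>: Pi A B; \<Gamma> \<turnstile> a \<^bold>: A\<rbrakk> \<Longrightarrow> \<Gamma> \<turnstile> App f a \<^bold>: inst B a"
| tm_Pair: "\<lbrakk>\<Gamma> \<turnstile> A \<^bold>t\<^bold>y\<^bold>p\<^bold>e; A # \<Gamma> \<turnstile> B \<^bold>t\<^bold>y\<^bold>p\<^bold>e; \<Gamma> \<turnstile> a \<^bold>: A; \<Gamma> \<turnstile> b \<^bold>: inst B a\<rbrakk>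
    \<Longrightarrow> \<Gamma> \<turnstile> Pair A B a b \<^bold>: Sig A B"
| tm_SigInd: "\<lbrakk>\<Gamma> \<turnstile> A \<^bold>t\<^bold>y\<^bold>p\<^bold>e; A # \<Gamma> \<turnstile> B \<^bold>t\<^bold>y\<^bold>p\<^bold>e; Sig A B # \<Gamma> \<turnstile> C \<^bold>t\<^bold>y\<^bold>p\<^bold>e;
     B # A # \<Gamma> \<turnstile> g \<^bold>: pair_inst A B C; \<Gamma> \<turnstile> p \<^bold>: Sig A B\<rbrakk>
    \<Longrightarrow> \<Gamma> \<turnstile> SigInd A B C g p \<^bold>: inst C p"
| tm_Refl: "\<lbrakk>\<Gamma> \<turnstile> A \<^bold>t\<^bold>y\<^bold>p\<^bold>e; \<Gamma> \<turnstile> a \<^bold>: A\<rbrakk> \<Longrightarrow> \<Gamma> \<turnstile> Refl A a \<^bold>: Id A a a"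
| tm_J: "\<lbrakk>\<Gamma> \<turnstile> A \<^bold>t\<^bold>y\<^bold>p\<^bold>e; \<Gamma> \<turnstile> a \<^bold>: A; Id (wk A) (wk a) (Var 0) # A # \<Gamma> \<turnstile> C \<^bold>t\<^bold>y\<^bold>p\<^bold>e;
     \<Gamma> \<turnstile> d \<^bold>: inst2 C a (Refl A a); \<Gamma> \<turnstile> b \<^bold>: A; \<Gamma> \<turnstile> p \<^bold>: Id A a b\<rbrakk>
    \<Longrightarrow> \<Gamma> \<turnstile> J A a C d b p \<^bold>: inst2 C b p"

| eq_refl: "\<Gamma> \<turnstile> t \<^bold>: A \<Longrightarrow> \<Gamma> \<turnstile> t \<doteq> t \<^bold>: A"
| eq_sym: "\<Gamma> \<turnstile> t \<doteq> u \<^bold>: A \<Longrightarrow> \<Gamma> \<turnstile> u \<doteq> t \<^bold>: A"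
| eq_trans: "\<lbrakk>\<Gamma> \<turnstile> t \<doteq> u \<^bold>: A; \<Gamma> \<turnstile> u \<doteq> v \<^bold>: A\<rbrakk> \<Longrightarrow> \<Gamma> \<turnstile> t \<doteq> v \<^bold>: A"
| eq_conv: "\<lbrakk>\<Gamma> \<turnstile> t \<doteq> u \<^bold>: A; \<Gamma> \<turnstile> A \<doteq> B \<^bold>t\<^bold>y\<^bold>p\<^bold>e\<rbrakk> \<Longrightarrow> \<Gamma> \<turnstile> t \<doteq> u \<^bold>: B"
| eq_Pi: "\<lbrakk>\<Gamma> \<turnstile> A \<^bold>: \<U>; \<Gamma> \<turnstile> A \<doteq> A' \<^bold>: \<U>; A # \<Gamma> \<turnstile> B \<doteq> B' \<^bold>: \<U>\<rbrakk> \<Longrightarrow> \<Gamma> \<turnstile> Pi A B \<doteq> Pi A' B' \<^bold>: \<U>"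
| eq_Sig: "\<lbrakk>\<Gamma> \<turnstile> A \<^bold>: \<U>; \<Gamma> \<turnstile> A \<doteq> A' \<^bold>: \<U>; A # \<Gamma> \<turnstile> B \<doteq> B' \<^bold>: \<U>\<rbrakk> \<Longrightarrow> \<Gamma> \<turnstile> Sig A B \<doteq> Sig A' B' \<^bold>: \<U>"
| eq_Id: "\<lbrakk>\<Gamma> \<turnstile> A \<doteq> A' \<^bold>: \<U>; \<Gamma> \<turnstile> a \<doteq> a' \<^bold>: A; \<Gamma> \<turnstile> b \<doteq> b' \<^bold>: A\<rbrakk>
    \<Longrightarrow> \<Gamma> \<turnstile> Id A a b \<doteq> Id A' a' b' \<^bold>: \<U>"
| eq_Lam: "\<lbrakk>\<Gamma> \<turnstile> A \<^bold>t\<^bold>y\<^bold>p\<^bold>e; \<Gamma> \<turnstile> A \<doteq> A' \<^bold>t\<^bold>y\<^bold>p\<^bold>e; A # \<Gamma> \<turnstile> b \<doteq> b' \<^bold>: B\<rbrakk>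
    \<Longrightarrow> \<Gamma> \<turnstile> Lam A b \<doteq> Lam A' b' \<^bold>: Pi A B"
| eq_App: "\<lbrakk>\<Gamma> \<turnstile> f \<doteq> f' \<^bold>: Pi A B; \<Gamma> \<turnstile> a \<doteq> a' \<^bold>: A\<rbrakk> \<Longrightarrow> \<Gamma> \<turnstile> App f a \<doteq> App f' a' \<^bold>: inst B a"
| eq_Pair: "\<lbrakk>\<Gamma> \<turnstile> A \<^bold>t\<^bold>y\<^bold>p\<^bold>e; \<Gamma> \<turnstile> A \<doteq> A' \<^bold>t\<^bold>y\<^bold>p\<^bold>e; A # \<Gamma> \<turnstile> B \<doteq> B' \<^bold>t\<^bold>y\<^bold>p\<^bold>e;
     \<Gamma> \<turnstile> a \<doteq> a' \<^bold>: A; \<Gamma> \<turnstile> b \<doteq> b' \<^bold>: inst B a\<rbrakk>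
    \<Longrightarrow> \<Gamma> \<turnstile> Pair A B a b \<doteq> Pair A' B' a' b' \<^bold>: Sig A B"
| eq_SigInd: "\<lbrakk>\<Gamma> \<turnstile> A \<^bold>t\<^bold>y\<^bold>p\<^bold>e; A # \<Gamma> \<turnstile> B \<^bold>t\<^bold>y\<^bold>p\<^bold>e; \<Gamma> \<turnstile> A \<doteq> A' \<^bold>t\<^bold>y\<^bold>p\<^bold>e; A # \<Gamma> \<turnstile> B \<doteq> B' \<^bold>t\<^bold>y\<^bold>p\<^bold>e;
     Sig A B # \<Gamma> \<turnstile> C \<doteq> C' \<^bold>t\<^bold>y\<^bold>p\<^bold>e; B # A # \<Gamma> \<turnstile> g \<doteq> g' \<^bold>: pair_inst A B C; \<Gamma> \<turnstile> p \<doteq> p' \<^bold>: Sig A B\<rbrakk>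
    \<Longrightarrow> \<Gamma> \<turnstile> SigInd A B C g p \<doteq> SigInd A' B' C' g' p' \<^bold>: inst C p"
| eq_Refl: "\<lbrakk>\<Gamma> \<turnstile> A \<doteq> A' \<^bold>t\<^bold>y\<^bold>p\<^bold>e; \<Gamma> \<turnstile> a \<doteq> a' \<^bold>: A\<rbrakk> \<Longrightarrow> \<Gamma> \<turnstile> Refl A a \<doteq> Refl A' a' \<^bold>: Id A a a"
| eq_J: "\<lbrakk>\<Gamma> \<turnstile> A \<^bold>t\<^bold>y\<^bold>p\<^bold>e; \<Gamma> \<turnstile> a \<^bold>: A; \<Gamma> \<turnstile> A \<doteq> A' \<^bold>t\<^bold>y\<^bold>p\<^bold>e; \<Gamma> \<turnstile> a \<doteq> a' \<^bold>: A;
     Id (wk A) (wk a) (Var 0) # A # \<Gamma> \<turnstile> C \<doteq> C' \<^bold>t\<^bold>y\<^bold>p\<^bold>e;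
     \<Gamma> \<turnstile> d \<doteq> d' \<^bold>: inst2 C a (Refl A a); \<Gamma> \<turnstile> b \<doteq> b' \<^bold>: A; \<Gamma> \<turnstile> p \<doteq> p' \<^bold>: Id A a b\<rbrakk>
    \<Longrightarrow> \<Gamma> \<turnstile> J A a C d b p \<doteq> J A' a' C' d' b' p' \<^bold>: inst2 C b p"
| Pi_beta: "\<lbrakk>\<Gamma> \<turnstile> A \<^bold>t\<^bold>y\<^bold>p\<^bold>e; A # \<Gamma> \<turnstile> b \<^bold>: B; \<Gamma> \<turnstile> a \<^bold>: A\<rbrakk>
    \<Longrightarrow> \<Gamma> \<turnstile> App (Lam A b) a \<doteq> inst b a \<^bold>: inst B a"
| Pi_eta: "\<Gamma> \<turnstile> f \<^bold>: Pi A B \<Longrightarrow> \<Gamma> \<turnstile> Lam A (App (wk f) (Var 0)) \<doteq> f \<^bold>: Pi A B"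
| Sig_beta: "\<lbrakk>\<Gamma> \<turnstile> A \<^bold>t\<^bold>y\<^bold>p\<^bold>e; A # \<Gamma> \<turnstile> B \<^bold>t\<^bold>y\<^bold>p\<^bold>e; Sig A B # \<Gamma> \<turnstile> C \<^bold>t\<^bold>y\<^bold>p\<^bold>e;
     B # A # \<Gamma> \<turnstile> g \<^bold>: pair_inst A B C; \<Gamma> \<turnstile> a \<^bold>: A; \<Gamma> \<turnstile> b \<^bold>: inst B a\<rbrakk>
    \<Longrightarrow> \<Gamma> \<turnstile> SigInd A B C g (Pair A B a b) \<doteq> inst2 g a b \<^bold>: inst C (Pair A B a b)"
| Id_beta: "\<lbrakk>\<Gamma> \<turnstile> A \<^bold>t\<^bold>y\<^bold>p\<^bold>e; \<Gamma> \<turnstile> a \<^bold>: A; Id (wk A) (wk a) (Var 0) # A # \<Gamma> \<turnstile> C \<^bold>t\<^bold>y\<^bold>p\<^bold>e;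
     \<Gamma> \<turnstile> d \<^bold>: inst2 C a (Refl A a)\<rbrakk>
    \<Longrightarrow> \<Gamma> \<turnstile> J A a C d a (Refl A a) \<doteq> d \<^bold>: inst2 C a (Refl A a)"

definition arr :: "tm \<Rightarrow> tm \<Rightarrow> tm" where
  "arr A B = Pi A (wk B)"

definition prod_ty :: "tm \<Rightarrow> tm \<Rightarrow> tm" where
  "prod_ty A B = Sig A (wk B)"

definition id_fun :: "tm \<Rightarrow> tm" where
  "id_fun A = Lam A (Var 0)"

text \<open>\<open>comp_fun A g f\<close> is the composite of \<open>g\<close> after \<open>f\<close>, where \<open>A\<close> is the domain of \<open>f\<close>.\<close>

definition comp_fun :: "tm \<Rightarrow> tm \<Rightarrow> tm \<Rightarrow> tm" where
  "comp_fun A g f = Lam A (App (wk g) (App (wk f) (Var 0)))"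

definition homotopy :: "tm \<Rightarrow> tm \<Rightarrow> tm \<Rightarrow> tm \<Rightarrow> tm" where
  "homotopy A B f g = Pi A (Id (wk B) (App (wk f) (Var 0)) (App (wk g) (Var 0)))"

text \<open>
  \<open>is_linv A B f\<close> and \<open>is_rinv A B f\<close> are families over a variable \<open>g\<close> of type \<open>B \<rightarrow> A\<close> (index 0):
  the types of homotopies from \<open>g \<circ> f\<close> to the identity of \<open>A\<close>, and from \<open>f \<circ> g\<close> to the identity
  of \<open>B\<close>.
\<close>

definition is_linv :: "tm \<Rightarrow> tm \<Rightarrow> tm \<Rightarrow> tm" where
  "is_linv A B f =
     homotopy (wk A) (wk A) (comp_fun (wk A) (Var 0) (wk f)) (id_fun (wk A))"

definition is_rinv :: "tm \<Rightarrow> tm \<Rightarrow> tm \<Rightarrow> tm" where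
  "is_rinv A B f =
     homotopy (wk B) (wk B) (comp_fun (wk B) (wk f) (Var 0)) (id_fun (wk B))"

definition linv :: "tm \<Rightarrow> tm \<Rightarrow> tm \<Rightarrow> tm" where
  "linv A B f = Sig (arr B A) (is_linv A B f)"

definition rinv :: "tm \<Rightarrow> tm \<Rightarrow> tm \<Rightarrow> tm" where
  "rinv A B f = Sig (arr B A) (is_rinv A B f)"

definition isEquiv :: "tm \<Rightarrow> tm \<Rightarrow> tm \<Rightarrow> tm" where
  "isEquiv A B f = prod_ty (linv A B f) (rinv A B f)"

definition equiv_ty :: "tm \<Rightarrow> tm \<Rightarrow> tm" where
  "equiv_ty A B = Sig (arr A B) (isEquiv (wk A) (wk B) (Var 0))"

definition id_isEquiv :: "tm \<Rightarrow> tm" where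
  "id_isEquiv A =
     Pair (linv A A (id_fun A)) (wk (rinv A A (id_fun A)))
       (Pair (arr A A) (is_linv A A (id_fun A)) (id_fun A) (Lam A (Refl (wk A) (Var 0))))
       (Pair (arr A A) (is_rinv A A (id_fun A)) (id_fun A) (Lam A (Refl (wk A) (Var 0))))"

definition id_equiv :: "tm \<Rightarrow> tm" where
  "id_equiv A = Pair (arr A A) (isEquiv (wk A) (wk A) (Var 0)) (id_fun A) (id_isEquiv A)"

text \<open>Path induction on \<open>p : A = B\<close> with motive \<open>A \<rightarrow> Y\<close>, respectively \<open>A \<simeq> Y\<close>, over \<open>Y : \<U>\<close> and \<open>A = Y\<close>.\<close>

definition idtofun :: "tm \<Rightarrow> tm \<Rightarrow> tm" where
  "idtofun A B =
     Lam (Id \<U> A B)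
       (J \<U> (wk A) (arr (wk (wk (wk A))) (Var 1)) (id_fun (wk A)) (wk B) (Var 0))"

definition idtoequiv :: "tm \<Rightarrow> tm \<Rightarrow> tm" where
  "idtoequiv A B =
     Lam (Id \<U> A B)
       (J \<U> (wk A) (equiv_ty (wk (wk (wk A))) (Var 1)) (id_equiv (wk A)) (wk B) (Var 0))"

definition isPIE :: "tm \<Rightarrow> tm \<Rightarrow> tm \<Rightarrow> tm" where
  "isPIE A B f =
     Sig (Id \<U> A B) (Id (arr (wk A) (wk B)) (wk f) (App (idtofun (wk A) (wk B)) (Var 0)))"

text \<open>The closed type \<open>\<Pi> A B : \<U>. isEquiv (idtoequiv A B)\<close>.\<close>

definition isUnivalent :: tm where
  "isUnivalent =
     Pi \<U> (Pi \<U>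
       (isEquiv (Id \<U> (Var 1) (Var 0)) (equiv_ty (Var 1) (Var 0)) (idtoequiv (Var 1) (Var 0))))"

text \<open>The closed type \<open>\<Pi> A B : \<U>. \<Pi> f : A \<rightarrow> B. isEquiv f \<rightarrow> isPIE f\<close>.\<close>

definition equivs_are_PIE :: tm where
  "equivs_are_PIE =
     Pi \<U> (Pi \<U> (Pi (arr (Var 1) (Var 0))
       (arr (isEquiv (Var 2) (Var 1) (Var 0)) (isPIE (Var 2) (Var 1) (Var 0)))))"

end

theory Submission
  imports Defs
begin

text \<open>
  From univalence to path-induced equivalences: if \<open>h\<close> is a right inverse of \<open>idtoequiv\<close> and \<open>p\<close> is
  \<open>h (f, e)\<close>, then \<open>idtoequiv p = (f, e)\<close>, and the underlying function of \<open>idtoequiv p\<close> is \<open>idtofun p\<close>.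

  For the converse, a map \<open>H : isEquiv f \<rightarrow> isPIE f\<close> turns every equivalence \<open>w : A \<simeq> B\<close> into a path
  \<open>s w : A = B\<close>. Since \<open>isEquiv\<close> asks for separate one-sided inverses, the left inverse of
  \<open>idtoequiv\<close> can be taken to be \<open>w \<mapsto> (s id)\<inverse> \<bullet> s w\<close>: by path induction it only has to send
  \<open>idtoequiv refl\<close> to \<open>refl\<close>, which it does whatever \<open>s\<close> is. The right inverse is \<open>s\<close> itself:
  by path induction this reduces to \<open>(id, e) = (id, e\<^sub>0)\<close> for every \<open>e : isEquiv id\<close>, hence to the
  contractibility of the type of all \<open>(g, \<eta>)\<close> with \<open>\<eta> : g \<sim> id\<close>. This instance of function
  extensionality follows from \<open>H\<close> by Voevodsky's argument: the target map of the path space of \<open>A\<close>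
  is an equivalence, hence equal to some \<open>idtofun p\<close>, hence postcomposition with it has contractible
  fibres, and \<open>(g, \<eta>)\<close> amounts to a lift of \<open>id\<close> along the target map.
\<close>

section \<open>Substitution calculus\<close>

lemma up_ren_simps [simp]: "up_ren r 0 = 0" "up_ren r (Suc n) = Suc (r n)"
  by (simp_all add: up_ren_def)

lemma cons_sub_simps [simp]: "cons_sub a s 0 = a" "cons_sub a s (Suc n) = s n"
  by (simp_all add: cons_sub_def)

lemma up_sub_simps [simp]: "up_sub s 0 = Var 0" "up_sub s (Suc n) = wk (s n)"
  by (simp_all add: up_sub_def)

lemma nat_fun_eqI: "f 0 = g 0 \<Longrightarrow> (\<And>n. f (Suc n) = g (Suc n)) \<Longrightarrow> f = (g :: nat \<Rightarrow> 'a)"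
  by (metis nat.exhaust ext)

lemma up_ren_comp: "up_ren (\<lambda>n. r (q n)) = (\<lambda>n. up_ren r (up_ren q n))"
  by (rule nat_fun_eqI) simp_all

lemma up_sub_up_ren: "up_sub (\<lambda>n. s (r n)) = (\<lambda>n. up_sub s (up_ren r n))"
  by (rule nat_fun_eqI) simp_all

text \<open>The four fusion laws have to come in this order: lifting a composite below a binder uses
  \<open>ren_ren\<close> in the proof of \<open>ren_sub\<close>, and both mixed laws in the proof of
  \<open>sub_sub\<close>.\<close>

lemma ren_ren: "ren r (ren q t) = ren (\<lambda>n. r (q n)) t"
  by (induction t arbitrary: r q) (simp_all add: up_ren_comp)

lemma sub_ren: "sub s (ren r t) = sub (\<lambda>n. s (r n)) t"
  by (induction t arbitrary: s r) (simp_all add: up_sub_up_ren)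

lemma up_sub_ren_after: "up_sub (\<lambda>n. ren r (s n)) = (\<lambda>n. ren (up_ren r) (up_sub s n))"
  by (rule nat_fun_eqI) (simp_all add: ren_ren)

lemma ren_sub: "ren r (sub s t) = sub (\<lambda>n. ren r (s n)) t"
  by (induction t arbitrary: s r) (simp_all add: up_sub_ren_after)

lemma up_sub_comp: "up_sub (\<lambda>n. sub s (q n)) = (\<lambda>n. sub (up_sub s) (up_sub q n))"
  by (rule nat_fun_eqI) (simp_all add: ren_sub sub_ren)

lemma sub_sub: "sub s (sub q t) = sub (\<lambda>n. sub s (q n)) t"
  by (induction t arbitrary: s q) (simp_all add: up_sub_comp)

lemma up_sub_Var: "up_sub Var = Var"
  by (rule nat_fun_eqI) simp_all

lemma sub_Var [simp]: "sub Var t = t"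
  by (induction t) (simp_all add: up_sub_Var)

lemma up_sub_Var_ren: "up_sub (\<lambda>n. Var (r n)) = (\<lambda>n. Var (up_ren r n))"
  by (rule nat_fun_eqI) simp_all

lemma ren_as_sub: "ren r t = sub (\<lambda>n. Var (r n)) t"
  by (induction t arbitrary: r) (simp_all add: up_sub_Var_ren)

lemma inst_wk [simp]: "inst (wk A) a = A"
  by (simp add: inst_def sub_ren)

lemma ren_up_wk: "ren (up_ren r) (wk t) = wk (ren r t)"
  by (simp add: ren_ren)

lemma sub_up_wk: "sub (up_sub s) (wk t) = wk (sub s t)"
  by (simp add: sub_ren ren_sub)

lemma sub_inst: "sub s (inst B a) = inst (sub (up_sub s) B) (sub s a)"
  unfolding inst_def sub_sub by (rule arg_cong[of _ _ "\<lambda>f. sub f B"], rule nat_fun_eqI)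
    (simp_all add: sub_ren)

lemma sub_inst2: "sub s (inst2 C a b) = inst2 (sub (up_sub (up_sub s)) C) (sub s a) (sub s b)"
  unfolding inst2_def sub_sub
  apply (rule arg_cong[of _ _ "\<lambda>f. sub f C"], rule nat_fun_eqI, simp)
  subgoal for n by (cases n) (simp_all add: sub_ren)
  done

lemma sub_pair_inst:
  "sub (up_sub (up_sub s)) (pair_inst A B C) =
   pair_inst (sub s A) (sub (up_sub s) B) (sub (up_sub s) C)"
proof -
  \<comment> \<open>In \<open>pair_inst\<close> the family \<open>B\<close> is weakened past the two
    components while its own variable stays fixed, so substitution must commute with that
    weakening.\<close>
  have "sub (up_sub (up_sub (up_sub s))) (ren (up_ren (\<lambda>n. n + 2)) B) =
        ren (up_ren (\<lambda>n. n + 2)) (sub (up_sub s) B)"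
    unfolding sub_ren ren_sub
    by (rule arg_cong[of _ _ "\<lambda>f. sub f B"], rule nat_fun_eqI) (simp_all add: ren_ren)
  then show ?thesis
    unfolding pair_inst_def sub_sub
    by (intro arg_cong[of _ _ "\<lambda>f. sub f C"] nat_fun_eqI)
      (simp_all add: sub_ren ren_sub ren_ren sub_sub ren_as_sub[of "\<lambda>n. Suc (Suc n)"])
qed

section \<open>Renaming, substitution and presuppositions\<close>

text \<open>The trivial clause keeps the shape of the simultaneous induction over the five
  judgements; later inductions are padded in the same way.\<close>

lemma judgement_wf_ctx:
  "wf_ctx \<Gamma> \<Longrightarrow> True"
  "\<Gamma> \<turnstile> A \<^bold>t\<^bold>y\<^bold>p\<^bold>e \<Longrightarrow> wf_ctx \<Gamma>"
  "\<Gamma> \<turnstile> A \<doteq> B \<^bold>t\<^bold>y\<^bold>p\<^bold>e \<Longrightarrow> wf_ctx \<Gamma>"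
  "\<Gamma> \<turnstile> t \<^bold>: A \<Longrightarrow> wf_ctx \<Gamma>"
  "\<Gamma> \<turnstile> t \<doteq> u \<^bold>: A \<Longrightarrow> wf_ctx \<Gamma>"
  by (induction rule: wf_ctx_is_type_eq_type_has_type_eq_term.inducts) simp_all

section \<open>Simultaneous substitution in judgements\<close>

definition var_ty :: "ctx \<Rightarrow> nat \<Rightarrow> tm" where
  "var_ty \<Gamma> n = ren (\<lambda>k. k + Suc n) (\<Gamma> ! n)"

lemma var_ty_Cons [simp]: "var_ty (A # \<Gamma>) 0 = wk A" "var_ty (A # \<Gamma>) (Suc n) = wk (var_ty \<Gamma> n)"
  by (simp_all add: var_ty_def ren_ren)


lemma all_less_Suc: "(\<forall>n<Suc m. P n) \<longleftrightarrow> P 0 \<and> (\<forall>n<m. P (Suc n))"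
  by (metis less_Suc_eq_0_disj not_less_eq)

lemma tm_Var0: "\<Gamma> \<turnstile> A \<^bold>t\<^bold>y\<^bold>p\<^bold>e \<Longrightarrow> A # \<Gamma> \<turnstile> Var 0 \<^bold>: wk A"
  using tm_Var[of "A # \<Gamma>" 0] by (auto intro: ctx_Cons judgement_wf_ctx)

text \<open>
  One induction serves both renamings and substitutions; the instance for renamings has to come first,
  because it provides the closure conditions for substitutions.
\<close>

locale substitution_class =
  fixes P :: "ctx \<Rightarrow> (nat \<Rightarrow> tm) \<Rightarrow> ctx \<Rightarrow> bool"
  assumes wf: "P \<Delta> s \<Gamma> \<Longrightarrow> wf_ctx \<Delta>"
    and var: "P \<Delta> s \<Gamma> \<Longrightarrow> n < length \<Gamma> \<Longrightarrow> \<Delta> \<turnstile> s n \<^bold>: sub s (var_ty \<Gamma> n)"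
    and up: "P \<Delta> s \<Gamma> \<Longrightarrow> \<Delta> \<turnstile> sub s A \<^bold>t\<^bold>y\<^bold>p\<^bold>e \<Longrightarrow> P (sub s A # \<Delta>) (up_sub s) (A # \<Gamma>)"
    and weaken: "P \<Delta> s \<Gamma> \<Longrightarrow> \<Delta> \<turnstile> A \<^bold>t\<^bold>y\<^bold>p\<^bold>e \<Longrightarrow> P (A # \<Delta>) (\<lambda>n. wk (s n)) \<Gamma>"
begin

lemma up_Sig:
  assumes "P \<Delta> s \<Gamma>" "\<Delta> \<turnstile> sub s A \<^bold>t\<^bold>y\<^bold>p\<^bold>e" "sub s A # \<Delta> \<turnstile> sub (up_sub s) B \<^bold>t\<^bold>y\<^bold>p\<^bold>e"
  shows "P (Sig (sub s A) (sub (up_sub s) B) # \<Delta>) (up_sub s) (Sig A B # \<Gamma>)"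
  using up[OF assms(1), of "Sig A B"] ty_Sig[OF assms(2,3)] by simp

text \<open>\<open>A\<close> and \<open>a\<close> are assumed typed under every map in the class
  because the type of the path variable lives in the context extended by \<open>A\<close>. There the
  weakened map is used, so no weakening lemma is presupposed.\<close>

lemma up2_Id:
  assumes s: "P \<Delta> s \<Gamma>" and A: "\<And>\<Delta> s. P \<Delta> s \<Gamma> \<Longrightarrow> \<Delta> \<turnstile> sub s A \<^bold>t\<^bold>y\<^bold>p\<^bold>e"
    and a: "\<And>\<Delta> s. P \<Delta> s \<Gamma> \<Longrightarrow> \<Delta> \<turnstile> sub s a \<^bold>: sub s A"
  shows "P (Id (wk (sub s A)) (wk (sub s a)) (Var 0) # sub s A # \<Delta>) (up_sub (up_sub s))
           (Id (wk A) (wk a) (Var 0) # A # \<Gamma>)"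
proof -
  note w = weaken[OF s A[OF s]]
  have "sub s A # \<Delta> \<turnstile> sub (up_sub s) (Id (wk A) (wk a) (Var 0)) \<^bold>t\<^bold>y\<^bold>p\<^bold>e"
    using ty_Id[OF A[OF w] a[OF w]] tm_Var0[OF A[OF s]] by (simp add: sub_ren ren_sub)
  from up[OF up[OF s A[OF s]] this] show ?thesis by (simp add: sub_up_wk)
qed

lemma judgement_sub:
  "wf_ctx \<Gamma> \<Longrightarrow> True"
  "\<Gamma> \<turnstile> A \<^bold>t\<^bold>y\<^bold>p\<^bold>e \<Longrightarrow> \<forall>\<Delta> s. P \<Delta> s \<Gamma> \<longrightarrow> \<Delta> \<turnstile> sub s A \<^bold>t\<^bold>y\<^bold>p\<^bold>e"
  "\<Gamma> \<turnstile> A \<doteq> B \<^bold>t\<^bold>y\<^bold>p\<^bold>e \<Longrightarrow> \<forall>\<Delta> s. P \<Delta> s \<Gamma> \<longrightarrow> \<Delta> \<turnstile> sub s A \<doteq> sub s B \<^bold>t\<^bold>y\<^bold>p\<^bold>e"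
  "\<Gamma> \<turnstile> t \<^bold>: A \<Longrightarrow> \<forall>\<Delta> s. P \<Delta> s \<Gamma> \<longrightarrow> \<Delta> \<turnstile> sub s t \<^bold>: sub s A"
  "\<Gamma> \<turnstile> t \<doteq> u \<^bold>: A \<Longrightarrow> \<forall>\<Delta> s. P \<Delta> s \<Gamma> \<longrightarrow> \<Delta> \<turnstile> sub s t \<doteq> sub s u \<^bold>: sub s A"
proof (induction rule: wf_ctx_is_type_eq_type_has_type_eq_term.inducts)
  case (tm_Var \<Gamma> n)
  then show ?case using var by (simp add: var_ty_def)
next
  case (tm_App \<Gamma> f A B a)
  then show ?case
    by (auto simp: sub_inst intro!: Defs.tm_App[of _ _ "sub s A" for s])
next
  case tm_Pair then show ?case
    by (auto simp: sub_inst up intro!: Defs.tm_Pair)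
next
  case tm_SigInd then show ?case
    by (auto simp: sub_inst sub_pair_inst[symmetric] up up_Sig intro!: Defs.tm_SigInd)
next
  case tm_J then show ?case
    by (auto simp: sub_inst2 up2_Id intro!: Defs.tm_J)
next
  case (eq_App \<Gamma> f f' A B a a')
  then show ?case
    by (auto simp: sub_inst intro!: Defs.eq_App[of _ _ _ "sub s A" for s])
next
  case eq_Pair then show ?case
    by (auto simp: sub_inst up intro!: Defs.eq_Pair)
next
  case eq_SigInd then show ?case
    by (auto simp: sub_inst sub_pair_inst[symmetric] up up_Sig intro!: Defs.eq_SigInd)
next
  case eq_J then show ?case
    by (auto simp: sub_inst2 up2_Id intro!: Defs.eq_J)
next
  case Pi_beta then show ?case
    by (auto simp: sub_inst up intro!: Defs.Pi_beta)
next
  case (Pi_eta \<Gamma> f A B)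
  then show ?case
    using Defs.Pi_eta by (fastforce simp: sub_up_wk)
next
  case Sig_beta then show ?case
    by (auto simp: sub_inst sub_inst2 sub_pair_inst[symmetric] up up_Sig intro!: Defs.Sig_beta)
next
  case Id_beta then show ?case
    by (auto simp: sub_inst2 up2_Id intro!: Defs.Id_beta)
next
  case eqty_trans then show ?case by (meson Defs.eqty_trans)
next
  case tm_conv then show ?case by (meson Defs.tm_conv)
next
  case tm_Pi then show ?case by (auto simp: up ty_El intro!: Defs.tm_Pi)
next
  case tm_Sig then show ?case by (auto simp: up ty_El intro!: Defs.tm_Sig)
next
  case eq_trans then show ?case by (meson Defs.eq_trans)
next
  case eq_conv then show ?case by (meson Defs.eq_conv)
next
  case eq_Pi then show ?case by (auto simp: up ty_El intro!: Defs.eq_Pi)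
next
  case eq_Sig then show ?case by (auto simp: up ty_El intro!: Defs.eq_Sig)
qed (auto simp: up wf intro: wf_ctx_is_type_eq_type_has_type_eq_term.intros)

end

text \<open>Renamings are encoded as substitutions whose values are variables. Types have to match
  on the nose, so closure under binders needs no weakening of typings.\<close>

definition is_ren :: "ctx \<Rightarrow> (nat \<Rightarrow> tm) \<Rightarrow> ctx \<Rightarrow> bool" where
  "is_ren \<Delta> s \<Gamma> \<longleftrightarrow> wf_ctx \<Delta> \<and>
     (\<forall>n<length \<Gamma>. \<exists>m<length \<Delta>. s n = Var m \<and> var_ty \<Delta> m = sub s (var_ty \<Gamma> n))"

interpretation ren: substitution_class is_ren
proof
  fix \<Delta> s \<Gamma> n
  assume "is_ren \<Delta> s \<Gamma>" "n < length \<Gamma>"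
  then show "\<Delta> \<turnstile> s n \<^bold>: sub s (var_ty \<Gamma> n)"
    unfolding is_ren_def by (metis tm_Var var_ty_def)
next
  fix \<Delta> s \<Gamma> A
  assume *: "is_ren \<Delta> s \<Gamma>" "\<Delta> \<turnstile> sub s A \<^bold>t\<^bold>y\<^bold>p\<^bold>e"
  have "\<exists>m<length (sub s A # \<Delta>). up_sub s (Suc n) = Var m \<and>
      var_ty (sub s A # \<Delta>) m = sub (up_sub s) (var_ty (A # \<Gamma>) (Suc n))" if "n < length \<Gamma>" for n
  proof -
    from * that obtain m where "m < length \<Delta>" "s n = Var m" "var_ty \<Delta> m = sub s (var_ty \<Gamma> n)"
      unfolding is_ren_def by blast
    then show ?thesis by (intro exI[of _ "Suc m"]) (simp add: sub_up_wk)
  qed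
  then show "is_ren (sub s A # \<Delta>) (up_sub s) (A # \<Gamma>)"
    using * unfolding is_ren_def
    by (auto simp: all_less_Suc sub_up_wk intro: ctx_Cons)
next
  fix \<Delta> s \<Gamma> A
  assume *: "is_ren \<Delta> s \<Gamma>" "\<Delta> \<turnstile> A \<^bold>t\<^bold>y\<^bold>p\<^bold>e"
  have "\<exists>m<length (A # \<Delta>). wk (s n) = Var m \<and>
      var_ty (A # \<Delta>) m = sub (\<lambda>n. wk (s n)) (var_ty \<Gamma> n)" if "n < length \<Gamma>" for n
  proof -
    from * that obtain m where "m < length \<Delta>" "s n = Var m" "var_ty \<Delta> m = sub s (var_ty \<Gamma> n)"
      unfolding is_ren_def by blast
    then show ?thesis by (intro exI[of _ "Suc m"]) (simp add: ren_sub)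
  qed
  then show "is_ren (A # \<Delta>) (\<lambda>n. wk (s n)) \<Gamma>"
    using * unfolding is_ren_def by (auto intro: ctx_Cons)
qed (simp add: is_ren_def)

lemma is_ren_Suc: "\<Gamma> \<turnstile> A \<^bold>t\<^bold>y\<^bold>p\<^bold>e \<Longrightarrow> is_ren (A # \<Gamma>) (\<lambda>n. Var (Suc n)) \<Gamma>"
  by (auto simp: is_ren_def ren_as_sub intro: ctx_Cons judgement_wf_ctx)

lemma weakening:
  assumes "\<Gamma> \<turnstile> X \<^bold>t\<^bold>y\<^bold>p\<^bold>e"
  shows "\<Gamma> \<turnstile> A \<^bold>t\<^bold>y\<^bold>p\<^bold>e \<Longrightarrow> X # \<Gamma> \<turnstile> wk A \<^bold>t\<^bold>y\<^bold>p\<^bold>e"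
    "\<Gamma> \<turnstile> A \<doteq> B \<^bold>t\<^bold>y\<^bold>p\<^bold>e \<Longrightarrow> X # \<Gamma> \<turnstile> wk A \<doteq> wk B \<^bold>t\<^bold>y\<^bold>p\<^bold>e"
    "\<Gamma> \<turnstile> t \<^bold>: A \<Longrightarrow> X # \<Gamma> \<turnstile> wk t \<^bold>: wk A"
    "\<Gamma> \<turnstile> t \<doteq> u \<^bold>: A \<Longrightarrow> X # \<Gamma> \<turnstile> wk t \<doteq> wk u \<^bold>: wk A"
  using ren.judgement_sub(2-5) is_ren_Suc[OF assms] unfolding ren_as_sub by blast+

definition is_sub :: "ctx \<Rightarrow> (nat \<Rightarrow> tm) \<Rightarrow> ctx \<Rightarrow> bool" where
  "is_sub \<Delta> s \<Gamma> \<longleftrightarrow> wf_ctx \<Delta> \<and> (\<forall>n<length \<Gamma>. \<Delta> \<turnstile> s n \<^bold>: sub s (var_ty \<Gamma> n))"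

interpretation sub: substitution_class is_sub
proof
  fix \<Delta> s \<Gamma> A
  assume *: "is_sub \<Delta> s \<Gamma>" "\<Delta> \<turnstile> sub s A \<^bold>t\<^bold>y\<^bold>p\<^bold>e"
  then show "is_sub (sub s A # \<Delta>) (up_sub s) (A # \<Gamma>)"
    by (auto simp: is_sub_def all_less_Suc sub_up_wk intro: ctx_Cons tm_Var0 weakening)
next
  fix \<Delta> s \<Gamma> A
  assume *: "is_sub \<Delta> s \<Gamma>" "\<Delta> \<turnstile> A \<^bold>t\<^bold>y\<^bold>p\<^bold>e"
  then show "is_sub (A # \<Delta>) (\<lambda>n. wk (s n)) \<Gamma>"
    by (auto simp: is_sub_def ren_sub[symmetric] intro: ctx_Cons weakening)
qed (simp_all add: is_sub_def)

lemma substitution: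
  assumes "is_sub \<Delta> s \<Gamma>"
  shows "\<Gamma> \<turnstile> A \<^bold>t\<^bold>y\<^bold>p\<^bold>e \<Longrightarrow> \<Delta> \<turnstile> sub s A \<^bold>t\<^bold>y\<^bold>p\<^bold>e"
    "\<Gamma> \<turnstile> A \<doteq> B \<^bold>t\<^bold>y\<^bold>p\<^bold>e \<Longrightarrow> \<Delta> \<turnstile> sub s A \<doteq> sub s B \<^bold>t\<^bold>y\<^bold>p\<^bold>e"
    "\<Gamma> \<turnstile> t \<^bold>: A \<Longrightarrow> \<Delta> \<turnstile> sub s t \<^bold>: sub s A"
    "\<Gamma> \<turnstile> t \<doteq> u \<^bold>: A \<Longrightarrow> \<Delta> \<turnstile> sub s t \<doteq> sub s u \<^bold>: sub s A"
  using sub.judgement_sub(2-5) assms by blast+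

lemma var_ty_type: "wf_ctx \<Gamma> \<Longrightarrow> n < length \<Gamma> \<Longrightarrow> \<Gamma> \<turnstile> var_ty \<Gamma> n \<^bold>t\<^bold>y\<^bold>p\<^bold>e"
proof (induction \<Gamma> arbitrary: n)
  case (Cons A \<Gamma>)
  then have "wf_ctx \<Gamma>" "\<Gamma> \<turnstile> A \<^bold>t\<^bold>y\<^bold>p\<^bold>e" by (auto elim: wf_ctx.cases)
  with Cons show ?case by (cases n) (auto intro: weakening)
qed simp

lemma is_sub_Var: "wf_ctx \<Gamma> \<Longrightarrow> is_sub \<Gamma> Var \<Gamma>"
  using tm_Var by (auto simp: is_sub_def var_ty_def)

lemma is_sub_cons:
  "is_sub \<Delta> s \<Gamma> \<Longrightarrow> \<Delta> \<turnstile> a \<^bold>: sub s A \<Longrightarrow> is_sub \<Delta> (cons_sub a s) (A # \<Gamma>)"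
  by (auto simp: is_sub_def all_less_Suc sub_ren)

text \<open>Well-typedness of both sides is part of the notion because an equality judgement is not
  yet known to have well-typed sides.\<close>

definition eq_sub :: "ctx \<Rightarrow> (nat \<Rightarrow> tm) \<Rightarrow> (nat \<Rightarrow> tm) \<Rightarrow> ctx \<Rightarrow> bool" where
  "eq_sub \<Delta> s s' \<Gamma> \<longleftrightarrow> is_sub \<Delta> s \<Gamma> \<and> is_sub \<Delta> s' \<Gamma> \<and>
     (\<forall>n<length \<Gamma>. \<Delta> \<turnstile> s n \<doteq> s' n \<^bold>: sub s (var_ty \<Gamma> n))"

lemma eq_sub_up:
  assumes e: "eq_sub \<Delta> s s' \<Gamma>" and A: "\<Gamma> \<turnstile> A \<^bold>t\<^bold>y\<^bold>p\<^bold>e" and A': "\<Delta> \<turnstile> sub s A \<doteq> sub s' A \<^bold>t\<^bold>y\<^bold>p\<^bold>e"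
  shows "eq_sub (sub s A # \<Delta>) (up_sub s) (up_sub s') (A # \<Gamma>)"
proof -
  have sA: "\<Delta> \<turnstile> sub s A \<^bold>t\<^bold>y\<^bold>p\<^bold>e" using e A substitution(1) by (auto simp: eq_sub_def)
  have "is_sub (sub s A # \<Delta>) (up_sub s) (A # \<Gamma>)" using e sA sub.up by (auto simp: eq_sub_def)
  \<comment> \<open>The new variable is declared with type \<open>sub s A\<close> and has to be
    converted to \<open>sub s' A\<close>.\<close>
  moreover have "is_sub (sub s A # \<Delta>) (up_sub s') (A # \<Gamma>)"
    using e sA tm_conv[OF tm_Var0[OF sA] weakening(2)[OF sA A']]
    by (auto simp: eq_sub_def is_sub_def all_less_Suc sub_up_wk intro: ctx_Cons weakening)
  ultimately show ?thesis
    using e sA by (auto simp: eq_sub_def all_less_Suc sub_up_wk intro: weakening eq_refl tm_Var0)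
qed

lemma eq_sub_subD:
  assumes "eq_sub \<Delta> s s' \<Gamma>"
  shows "\<Gamma> \<turnstile> A \<^bold>t\<^bold>y\<^bold>p\<^bold>e \<Longrightarrow> \<Delta> \<turnstile> sub s A \<^bold>t\<^bold>y\<^bold>p\<^bold>e"
    "\<Gamma> \<turnstile> A \<doteq> B \<^bold>t\<^bold>y\<^bold>p\<^bold>e \<Longrightarrow> \<Delta> \<turnstile> sub s A \<doteq> sub s B \<^bold>t\<^bold>y\<^bold>p\<^bold>e"
    "\<Gamma> \<turnstile> t \<^bold>: A \<Longrightarrow> \<Delta> \<turnstile> sub s t \<^bold>: sub s A"
  using assms by (auto simp: eq_sub_def intro: substitution)

text \<open>This compares dependent types such as \<open>inst B a\<close> and
  \<open>inst B a'\<close>. Equations are treated afterwards by combining it with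
  \<open>substitution\<close>, as in \<open>inst_type_eq\<close>, so their clauses are trivial
  here.\<close>

lemma functionality:
  "wf_ctx \<Gamma> \<Longrightarrow> True"
  "\<Gamma> \<turnstile> A \<^bold>t\<^bold>y\<^bold>p\<^bold>e \<Longrightarrow> \<forall>\<Delta> s s'. eq_sub \<Delta> s s' \<Gamma> \<longrightarrow> \<Delta> \<turnstile> sub s A \<doteq> sub s' A \<^bold>t\<^bold>y\<^bold>p\<^bold>e"
  "\<Gamma> \<turnstile> A \<doteq> B \<^bold>t\<^bold>y\<^bold>p\<^bold>e \<Longrightarrow> True"
  "\<Gamma> \<turnstile> t \<^bold>: A \<Longrightarrow> \<forall>\<Delta> s s'. eq_sub \<Delta> s s' \<Gamma> \<longrightarrow> \<Delta> \<turnstile> sub s t \<doteq> sub s' t \<^bold>: sub s A"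
  "\<Gamma> \<turnstile> t \<doteq> u \<^bold>: A \<Longrightarrow> True"
proof (induction rule: wf_ctx_is_type_eq_type_has_type_eq_term.inducts)
  case (tm_Var \<Gamma> n)
  then show ?case by (simp add: eq_sub_def var_ty_def)
next
  case (tm_App \<Gamma> f A B a)
  then show ?case
    by (auto simp: sub_inst intro!: eq_App[of _ _ _ "sub s A" for s])
next
  case tm_Pair then show ?case
    by (auto simp: sub_inst eq_sub_up intro!: eq_Pair intro: eq_sub_subD eq_sub_subD(1)[OF eq_sub_up])
next
  case (tm_SigInd \<Gamma> A B C g p)
  show ?case
  proof (intro allI impI)
    fix \<Delta> s s' assume e: "eq_sub \<Delta> s s' \<Gamma>"
    then have A: "\<Delta> \<turnstile> sub s A \<doteq> sub s' A \<^bold>t\<^bold>y\<^bold>p\<^bold>e" using tm_SigInd.IH by blast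
    note e1 = eq_sub_up[OF e tm_SigInd.hyps(1) A]
    then have B: "sub s A # \<Delta> \<turnstile> sub (up_sub s) B \<doteq> sub (up_sub s') B \<^bold>t\<^bold>y\<^bold>p\<^bold>e"
      using tm_SigInd.IH by blast
    note e2 = eq_sub_up[OF e1 tm_SigInd.hyps(2) B]
    have sA: "\<Delta> \<turnstile> sub s A \<^bold>t\<^bold>y\<^bold>p\<^bold>e" "sub s A # \<Delta> \<turnstile> sub (up_sub s) B \<^bold>t\<^bold>y\<^bold>p\<^bold>e"
      using eq_sub_subD(1)[OF e] eq_sub_subD(1)[OF e1] tm_SigInd.hyps by auto
    have "\<Delta> \<turnstile> sub s (Sig A B) \<doteq> sub s' (Sig A B) \<^bold>t\<^bold>y\<^bold>p\<^bold>e"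
      using eqty_Sig[OF sA(1) A B] by simp
    note e3 = eq_sub_up[OF e Defs.ty_Sig[OF tm_SigInd.hyps(1,2)] this]
    show "\<Delta> \<turnstile> sub s (SigInd A B C g p) \<doteq> sub s' (SigInd A B C g p) \<^bold>: sub s (inst C p)"
      using tm_SigInd.IH(3-5) e e2 e3 sA A B unfolding sub.simps sub_inst
      by (intro eq_SigInd) (auto simp: sub_pair_inst[symmetric])
  qed
next
  case (tm_J \<Gamma> A a C d b p)
  show ?case
  proof (intro allI impI)
    fix \<Delta> s s' assume e: "eq_sub \<Delta> s s' \<Gamma>"
    then have A: "\<Delta> \<turnstile> sub s A \<doteq> sub s' A \<^bold>t\<^bold>y\<^bold>p\<^bold>e" and a: "\<Delta> \<turnstile> sub s a \<doteq> sub s' a \<^bold>: sub s A"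
      using tm_J.IH by blast+
    have sA: "\<Delta> \<turnstile> sub s A \<^bold>t\<^bold>y\<^bold>p\<^bold>e" "\<Delta> \<turnstile> sub s a \<^bold>: sub s A"
      using eq_sub_subD[OF e] tm_J.hyps by auto
    note e1 = eq_sub_up[OF e tm_J.hyps(1) A]
    have I: "A # \<Gamma> \<turnstile> Id (wk A) (wk a) (Var 0) \<^bold>t\<^bold>y\<^bold>p\<^bold>e"
      using tm_J.hyps by (intro Defs.ty_Id weakening tm_Var0)
    have "sub s A # \<Delta> \<turnstile> sub (up_sub s) (Id (wk A) (wk a) (Var 0))
        \<doteq> sub (up_sub s') (Id (wk A) (wk a) (Var 0)) \<^bold>t\<^bold>y\<^bold>p\<^bold>e"
      using A a sA by (auto simp: sub_up_wk intro!: eqty_Id weakening eq_refl tm_Var0)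
    note e2 = eq_sub_up[OF e1 I this]
    show "\<Delta> \<turnstile> sub s (J A a C d b p) \<doteq> sub s' (J A a C d b p) \<^bold>: sub s (inst2 C b p)"
      using tm_J.IH(3-6) e e2 sA A a unfolding sub.simps sub_inst2
      by (intro eq_J) (auto simp: sub_inst2 sub_up_wk)
  qed
next
  case tm_conv then show ?case by (meson eq_conv eq_sub_subD)
next
  case tm_Pi then show ?case
    by (auto simp: eq_sub_up ty_El eqty_El eq_sub_subD(3)[of _ _ _ _ _ \<U>, simplified] intro!: eq_Pi)
next
  case tm_Sig then show ?case
    by (auto simp: eq_sub_up ty_El eqty_El eq_sub_subD(3)[of _ _ _ _ _ \<U>, simplified] intro!: eq_Sig)
next
  case tm_Id then show ?case by (auto intro!: eq_Id)
next
  case tm_Lam then show ?case by (auto simp: eq_sub_up eq_sub_subD intro!: eq_Lam)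
next
  case tm_Refl then show ?case by (auto intro!: eq_Refl)
next
  case ty_U then show ?case by (auto simp: eq_sub_def is_sub_def intro!: eqty_refl Defs.ty_U)
next
  case ty_El then show ?case by (auto intro!: eqty_El)
next
  case ty_Pi then show ?case by (auto simp: eq_sub_up eq_sub_subD intro!: eqty_Pi)
next
  case ty_Sig then show ?case by (auto simp: eq_sub_up eq_sub_subD intro!: eqty_Sig)
next
  case ty_Id then show ?case by (auto intro!: eqty_Id)
qed simp_all


section \<open>Instances at one and at two terms\<close>

lemma inst_sub:
  assumes "\<Gamma> \<turnstile> a \<^bold>: A"
  shows "is_sub \<Gamma> (cons_sub a Var) (A # \<Gamma>)"
  using is_sub_cons[OF is_sub_Var, of \<Gamma> a A] judgement_wf_ctx(4)[OF assms] assms by simp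

lemma inst2_sub:
  assumes "\<Gamma> \<turnstile> a \<^bold>: A" "\<Gamma> \<turnstile> b \<^bold>: inst B a"
  shows "is_sub \<Gamma> (cons_sub b (cons_sub a Var)) (B # A # \<Gamma>)"
  using is_sub_cons[OF inst_sub[OF assms(1)], of b B] assms(2) by (simp add: inst_def)

lemma inst_cong_sub:
  assumes "\<Gamma> \<turnstile> a \<^bold>: A" "\<Gamma> \<turnstile> a' \<^bold>: A" "\<Gamma> \<turnstile> a \<doteq> a' \<^bold>: A"
  shows "eq_sub \<Gamma> (cons_sub a Var) (cons_sub a' Var) (A # \<Gamma>)"
  using inst_sub[OF assms(1)] inst_sub[OF assms(2)] assms is_sub_Var[of \<Gamma>]
  by (auto simp: eq_sub_def is_sub_def all_less_Suc sub_ren intro: eq_refl)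

lemma inst_cong:
  assumes "A # \<Gamma> \<turnstile> B \<^bold>t\<^bold>y\<^bold>p\<^bold>e" "\<Gamma> \<turnstile> a \<^bold>: A" "\<Gamma> \<turnstile> a' \<^bold>: A" "\<Gamma> \<turnstile> a \<doteq> a' \<^bold>: A"
  shows "\<Gamma> \<turnstile> inst B a \<doteq> inst B a' \<^bold>t\<^bold>y\<^bold>p\<^bold>e"
  unfolding inst_def using functionality(2)[OF assms(1)] inst_cong_sub[OF assms(2-4)] by blast

lemma inst2_cong_sub:
  assumes "\<Gamma> \<turnstile> a \<^bold>: A" "\<Gamma> \<turnstile> a' \<^bold>: A" "\<Gamma> \<turnstile> a \<doteq> a' \<^bold>: A"
    and "\<Gamma> \<turnstile> b \<^bold>: inst B a" "\<Gamma> \<turnstile> b' \<^bold>: inst B a'" "\<Gamma> \<turnstile> b \<doteq> b' \<^bold>: inst B a"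
  shows "eq_sub \<Gamma> (cons_sub b (cons_sub a Var)) (cons_sub b' (cons_sub a' Var)) (B # A # \<Gamma>)"
  using inst2_sub[OF assms(1,4)] inst2_sub[OF assms(2,5)] assms(6) inst_cong_sub[OF assms(1-3)]
  by (auto simp: eq_sub_def is_sub_def all_less_Suc sub_ren inst_def)

lemma inst2_cong:
  assumes "B # A # \<Gamma> \<turnstile> C \<^bold>t\<^bold>y\<^bold>p\<^bold>e" "\<Gamma> \<turnstile> a \<^bold>: A" "\<Gamma> \<turnstile> a' \<^bold>: A" "\<Gamma> \<turnstile> a \<doteq> a' \<^bold>: A"
    and "\<Gamma> \<turnstile> b \<^bold>: inst B a" "\<Gamma> \<turnstile> b' \<^bold>: inst B a'" "\<Gamma> \<turnstile> b \<doteq> b' \<^bold>: inst B a"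
  shows "\<Gamma> \<turnstile> inst2 C a b \<doteq> inst2 C a' b' \<^bold>t\<^bold>y\<^bold>p\<^bold>e"
  unfolding inst2_def using functionality(2)[OF assms(1)] inst2_cong_sub[OF assms(2-7)] by blast

text \<open>Context conversion is substitution by \<open>Var\<close>, regarded as a map between
  contexts with judgementally equal entries, so it needs no induction over derivations of its
  own.\<close>

lemma is_sub_ctx_conv:
  assumes "is_sub \<Delta> Var \<Gamma>" "\<Delta> \<turnstile> A \<^bold>t\<^bold>y\<^bold>p\<^bold>e" "\<Delta> \<turnstile> A \<doteq> A' \<^bold>t\<^bold>y\<^bold>p\<^bold>e"
  shows "is_sub (A # \<Delta>) Var (A' # \<Gamma>)"
  using assms(1,2) tm_conv[OF tm_Var0[OF assms(2)] weakening(2)[OF assms(2,3)]]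
    weakening(3)[OF assms(2), of "Var n" for n]
  by (auto simp: is_sub_def all_less_Suc intro: ctx_Cons)

lemma ctx_conv:
  assumes "is_sub \<Delta> Var \<Gamma>"
  shows "\<Gamma> \<turnstile> A \<^bold>t\<^bold>y\<^bold>p\<^bold>e \<Longrightarrow> \<Delta> \<turnstile> A \<^bold>t\<^bold>y\<^bold>p\<^bold>e"
    "\<Gamma> \<turnstile> A \<doteq> B \<^bold>t\<^bold>y\<^bold>p\<^bold>e \<Longrightarrow> \<Delta> \<turnstile> A \<doteq> B \<^bold>t\<^bold>y\<^bold>p\<^bold>e"
    "\<Gamma> \<turnstile> t \<^bold>: A \<Longrightarrow> \<Delta> \<turnstile> t \<^bold>: A"
    "\<Gamma> \<turnstile> t \<doteq> u \<^bold>: A \<Longrightarrow> \<Delta> \<turnstile> t \<doteq> u \<^bold>: A"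
  using substitution[OF assms] by auto

text \<open>Induction is needed because \<open>tm_conv\<close> can be repeated without changing the
  subject; apart from it only \<open>tm_Pi\<close> and \<open>tm_Sig\<close> type these
  terms.\<close>

lemma has_type_formerD:
  "wf_ctx \<Gamma> \<Longrightarrow> True" "\<Gamma> \<turnstile> X \<^bold>t\<^bold>y\<^bold>p\<^bold>e \<Longrightarrow> True" "\<Gamma> \<turnstile> X \<doteq> Y \<^bold>t\<^bold>y\<^bold>p\<^bold>e \<Longrightarrow> True"
  "\<Gamma> \<turnstile> X \<^bold>: T \<Longrightarrow> \<forall>A B. X = Pi A B \<or> X = Sig A B \<longrightarrow> \<Gamma> \<turnstile> A \<^bold>: \<U> \<and> A # \<Gamma> \<turnstile> B \<^bold>: \<U>"
  "\<Gamma> \<turnstile> t \<doteq> u \<^bold>: T \<Longrightarrow> True"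
  by (induction rule: wf_ctx_is_type_eq_type_has_type_eq_term.inducts) auto

lemma is_type_PiD: "\<Gamma> \<turnstile> Pi A B \<^bold>t\<^bold>y\<^bold>p\<^bold>e \<Longrightarrow> \<Gamma> \<turnstile> A \<^bold>t\<^bold>y\<^bold>p\<^bold>e \<and> A # \<Gamma> \<turnstile> B \<^bold>t\<^bold>y\<^bold>p\<^bold>e"
  by (erule is_type.cases) (auto dest: has_type_formerD(4) intro: ty_El)


lemma is_sub_ctx_conv1:
  "\<Gamma> \<turnstile> A' \<^bold>t\<^bold>y\<^bold>p\<^bold>e \<Longrightarrow> \<Gamma> \<turnstile> A \<doteq> A' \<^bold>t\<^bold>y\<^bold>p\<^bold>e \<Longrightarrow> is_sub (A' # \<Gamma>) Var (A # \<Gamma>)"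
  by (meson is_sub_ctx_conv is_sub_Var eqty_sym judgement_wf_ctx(2))

lemma is_sub_ctx_conv2:
  assumes "\<Gamma> \<turnstile> A' \<^bold>t\<^bold>y\<^bold>p\<^bold>e" "\<Gamma> \<turnstile> A \<doteq> A' \<^bold>t\<^bold>y\<^bold>p\<^bold>e" "A # \<Gamma> \<turnstile> B' \<^bold>t\<^bold>y\<^bold>p\<^bold>e" "A # \<Gamma> \<turnstile> B \<doteq> B' \<^bold>t\<^bold>y\<^bold>p\<^bold>e"
  shows "is_sub (B' # A' # \<Gamma>) Var (B # A # \<Gamma>)"
  using is_sub_ctx_conv1[OF assms(1,2)] assms(3,4) by (meson is_sub_ctx_conv ctx_conv eqty_sym)

lemma inst_type_eq:
  assumes "A # \<Gamma> \<turnstile> B \<doteq> B' \<^bold>t\<^bold>y\<^bold>p\<^bold>e" "A # \<Gamma> \<turnstile> B \<^bold>t\<^bold>y\<^bold>p\<^bold>e"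
    and "\<Gamma> \<turnstile> a \<^bold>: A" "\<Gamma> \<turnstile> a' \<^bold>: A" "\<Gamma> \<turnstile> a \<doteq> a' \<^bold>: A"
  shows "\<Gamma> \<turnstile> inst B a \<doteq> inst B' a' \<^bold>t\<^bold>y\<^bold>p\<^bold>e"
  using inst_cong[OF assms(2-5)] substitution(2)[OF inst_sub[OF assms(4)] assms(1)]
  by (auto simp: inst_def intro: eqty_trans)

section \<open>Contexts and motives of path induction\<close>

lemma path_ctx:
  "\<Gamma> \<turnstile> A \<^bold>t\<^bold>y\<^bold>p\<^bold>e \<Longrightarrow> \<Gamma> \<turnstile> a \<^bold>: A \<Longrightarrow> A # \<Gamma> \<turnstile> Id (wk A) (wk a) (Var 0) \<^bold>t\<^bold>y\<^bold>p\<^bold>e"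
  by (intro ty_Id weakening tm_Var0)

lemma inst_path [simp]: "inst (Id (wk A) (wk a) (Var 0)) b = Id A a b"
  by (simp add: inst_def sub_ren)

lemma inst2_type_eq:
  assumes "Id (wk A) (wk a) (Var 0) # A # \<Gamma> \<turnstile> C \<doteq> C' \<^bold>t\<^bold>y\<^bold>p\<^bold>e"
    and "Id (wk A) (wk a) (Var 0) # A # \<Gamma> \<turnstile> C \<^bold>t\<^bold>y\<^bold>p\<^bold>e"
    and "\<Gamma> \<turnstile> b \<^bold>: A" "\<Gamma> \<turnstile> b' \<^bold>: A" "\<Gamma> \<turnstile> b \<doteq> b' \<^bold>: A"
    and "\<Gamma> \<turnstile> p \<^bold>: Id A a b" "\<Gamma> \<turnstile> p' \<^bold>: Id A a b'" "\<Gamma> \<turnstile> p \<doteq> p' \<^bold>: Id A a b"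
  shows "\<Gamma> \<turnstile> inst2 C b p \<doteq> inst2 C' b' p' \<^bold>t\<^bold>y\<^bold>p\<^bold>e"
  using inst2_cong[OF assms(2-5), of p p'] assms(6-8)
    substitution(2)[OF inst2_sub[OF assms(4), of p'] assms(1)]
  by (auto simp: inst2_def intro: eqty_trans)

lemma is_sub_path_conv:
  assumes "\<Gamma> \<turnstile> A \<^bold>t\<^bold>y\<^bold>p\<^bold>e" "\<Gamma> \<turnstile> A' \<^bold>t\<^bold>y\<^bold>p\<^bold>e" "\<Gamma> \<turnstile> A \<doteq> A' \<^bold>t\<^bold>y\<^bold>p\<^bold>e"
    and "\<Gamma> \<turnstile> a \<^bold>: A" "\<Gamma> \<turnstile> a' \<^bold>: A" "\<Gamma> \<turnstile> a \<doteq> a' \<^bold>: A"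
  shows "is_sub (Id (wk A') (wk a') (Var 0) # A' # \<Gamma>) Var (Id (wk A) (wk a) (Var 0) # A # \<Gamma>)"
proof (rule is_sub_ctx_conv2[OF assms(2,3)])
  have v: "A # \<Gamma> \<turnstile> Var 0 \<^bold>: wk A" by (rule tm_Var0[OF assms(1)])
  note A' = weakening(2)[OF assms(1,3)]
  show "A # \<Gamma> \<turnstile> Id (wk A') (wk a') (Var 0) \<^bold>t\<^bold>y\<^bold>p\<^bold>e"
    using assms A' v by (auto intro!: ty_Id intro: weakening tm_conv)
  show "A # \<Gamma> \<turnstile> Id (wk A) (wk a) (Var 0) \<doteq> Id (wk A') (wk a') (Var 0) \<^bold>t\<^bold>y\<^bold>p\<^bold>e"
    using assms v by (intro eqty_Id weakening eq_refl)
qed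

lemma inst_up_Var0 [simp]: "inst (ren (up_ren Suc) B) (Var 0) = B"
proof -
  have "(\<lambda>n. cons_sub (Var 0) Var (up_ren Suc n)) = Var" by (rule nat_fun_eqI) simp_all
  then show ?thesis by (simp add: inst_def sub_ren)
qed

text \<open>This gives the right-hand side of \<open>Sig_beta\<close> the same type as the left-hand
  side.\<close>

lemma inst2_pair_inst: "inst2 (pair_inst A B C) a b = inst C (Pair A B a b)"
proof -
  have "(\<lambda>n. cons_sub b (cons_sub a Var) (n + 2)) = Var" by (rule ext) simp
  moreover have "(\<lambda>n. up_sub (cons_sub b (cons_sub a Var)) (up_ren (\<lambda>n. n + 2) n)) = Var"
    by (rule nat_fun_eqI) simp_all
  ultimately show ?thesis
    unfolding inst2_def inst_def pair_inst_def sub_sub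
    by (intro arg_cong[of _ _ "\<lambda>f. sub f C"] nat_fun_eqI) (simp_all add: sub_ren)
qed

section \<open>The branch type of the \<Sigma> eliminator\<close>

abbreviation wk2_under :: "tm \<Rightarrow> tm" where
  "wk2_under \<equiv> ren (up_ren (\<lambda>n. n + 2))"

lemma sub_Var_add2: "sub (\<lambda>n. Var (n + 2)) t = wk (wk t)"
  by (simp add: ren_as_sub sub_sub)

lemma inst_wk2_under: "inst (wk2_under B) (Var 1) = wk B"
  unfolding inst_def sub_ren ren_as_sub[of Suc]
  by (rule arg_cong[of _ _ "\<lambda>f. sub f B"], rule nat_fun_eqI) simp_all

lemma sub_up_Var_add2: "sub (up_sub (\<lambda>n. Var (n + 2))) B = wk2_under B"
  unfolding ren_as_sub by (rule arg_cong[of _ _ "\<lambda>f. sub f B"], rule nat_fun_eqI) simp_all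

lemma sub_Sig_add2: "sub (\<lambda>n. Var (n + 2)) (Sig A B) = Sig (wk (wk A)) (wk2_under B)"
  by (subst sub.simps) (simp only: sub_Var_add2 sub_up_Var_add2)

context
  fixes \<Gamma> A B
  assumes A: "\<Gamma> \<turnstile> A \<^bold>t\<^bold>y\<^bold>p\<^bold>e" and B: "A # \<Gamma> \<turnstile> B \<^bold>t\<^bold>y\<^bold>p\<^bold>e"
begin

lemma is_sub_Var_add2: "is_sub (B # A # \<Gamma>) (\<lambda>n. Var (n + 2)) \<Gamma>"
  using sub.weaken[OF sub.weaken[OF is_sub_Var A] B] A judgement_wf_ctx by fastforce

lemma weakening2:
  "\<Gamma> \<turnstile> X \<^bold>t\<^bold>y\<^bold>p\<^bold>e \<Longrightarrow> B # A # \<Gamma> \<turnstile> wk (wk X) \<^bold>t\<^bold>y\<^bold>p\<^bold>e"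
  "\<Gamma> \<turnstile> X \<doteq> Y \<^bold>t\<^bold>y\<^bold>p\<^bold>e \<Longrightarrow> B # A # \<Gamma> \<turnstile> wk (wk X) \<doteq> wk (wk Y) \<^bold>t\<^bold>y\<^bold>p\<^bold>e"
  using A B by (simp_all add: weakening)

lemma weakening2_under:
  assumes X: "\<Gamma> \<turnstile> X \<^bold>t\<^bold>y\<^bold>p\<^bold>e"
  shows "X # \<Gamma> \<turnstile> Y \<^bold>t\<^bold>y\<^bold>p\<^bold>e \<Longrightarrow> wk (wk X) # B # A # \<Gamma> \<turnstile> wk2_under Y \<^bold>t\<^bold>y\<^bold>p\<^bold>e"
    "X # \<Gamma> \<turnstile> Y \<doteq> Z \<^bold>t\<^bold>y\<^bold>p\<^bold>e \<Longrightarrow> wk (wk X) # B # A # \<Gamma> \<turnstile> wk2_under Y \<doteq> wk2_under Z \<^bold>t\<^bold>y\<^bold>p\<^bold>e"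
  using substitution(1,2)[OF sub.up[OF is_sub_Var_add2, of X]] weakening2(1)[OF X]
  by (simp_all only: sub_Var_add2 sub_up_Var_add2)

lemma Vars_type: "B # A # \<Gamma> \<turnstile> Var 1 \<^bold>: wk (wk A)" "B # A # \<Gamma> \<turnstile> Var 0 \<^bold>: inst (wk2_under B) (Var 1)"
  using weakening(3)[OF B tm_Var0[OF A]] tm_Var0[OF B] by (simp_all only: inst_wk2_under) simp_all

lemma pair_var_type:
  "B # A # \<Gamma> \<turnstile> Pair (wk (wk A)) (wk2_under B) (Var 1) (Var 0) \<^bold>: Sig (wk (wk A)) (wk2_under B)"
  using A B weakening2 weakening2_under Vars_type by (intro tm_Pair)

lemma pair_sub:
  "is_sub (B # A # \<Gamma>) (cons_sub (Pair (wk (wk A)) (wk2_under B) (Var 1) (Var 0)) (\<lambda>n. Var (n + 2)))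
     (Sig A B # \<Gamma>)"
  using pair_var_type
  by (intro is_sub_cons is_sub_Var_add2) (simp only: sub_Sig_add2)

text \<open>\<open>eq_SigInd\<close> types the branch \<open>g'\<close> by the unprimed data,
  whereas its right-hand side needs the primed ones. Pairing with primed annotations is an equal
  substitution, so \<open>functionality\<close> changes the pair and \<open>substitution\<close>
  then changes the motive.\<close>

lemma pair_inst_type_eq:
  assumes A': "\<Gamma> \<turnstile> A' \<^bold>t\<^bold>y\<^bold>p\<^bold>e" "\<Gamma> \<turnstile> A \<doteq> A' \<^bold>t\<^bold>y\<^bold>p\<^bold>e" and B': "A # \<Gamma> \<turnstile> B' \<^bold>t\<^bold>y\<^bold>p\<^bold>e" "A # \<Gamma> \<turnstile> B \<doteq> B' \<^bold>t\<^bold>y\<^bold>p\<^bold>e"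
    and C: "Sig A B # \<Gamma> \<turnstile> C \<^bold>t\<^bold>y\<^bold>p\<^bold>e" "Sig A B # \<Gamma> \<turnstile> C \<doteq> C' \<^bold>t\<^bold>y\<^bold>p\<^bold>e"
  shows "B # A # \<Gamma> \<turnstile> pair_inst A B C \<doteq> pair_inst A' B' C' \<^bold>t\<^bold>y\<^bold>p\<^bold>e"
proof -
  let ?\<Delta> = "B # A # \<Gamma>"
  let ?p = "Pair (wk (wk A)) (wk2_under B) (Var 1) (Var 0)"
  let ?p' = "Pair (wk (wk A')) (wk2_under B') (Var 1) (Var 0)"
  have S: "?\<Delta> \<turnstile> Sig (wk (wk A)) (wk2_under B) \<doteq> Sig (wk (wk A')) (wk2_under B') \<^bold>t\<^bold>y\<^bold>p\<^bold>e"
    using A A' B' weakening2 weakening2_under by (intro eqty_Sig)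
  have e: "?\<Delta> \<turnstile> ?p \<doteq> ?p' \<^bold>: Sig (wk (wk A)) (wk2_under B)"
    using A A' B' weakening2 weakening2_under Vars_type by (intro eq_Pair eq_refl)
  have B'': "A' # \<Gamma> \<turnstile> B' \<^bold>t\<^bold>y\<^bold>p\<^bold>e" using ctx_conv(1)[OF is_sub_ctx_conv1[OF A']] B'(1) .
  have v: "?\<Delta> \<turnstile> Var 1 \<^bold>: wk (wk A')" using Vars_type(1) weakening2(2)[OF A'(2)] by (rule tm_conv)
  have "?\<Delta> \<turnstile> inst (wk2_under B) (Var 1) \<doteq> inst (wk2_under B') (Var 1) \<^bold>t\<^bold>y\<^bold>p\<^bold>e"
    unfolding inst_wk2_under using B B'(2) by (rule weakening)
  from tm_conv[OF Vars_type(2) this]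
  have "?\<Delta> \<turnstile> ?p' \<^bold>: Sig (wk (wk A')) (wk2_under B')"
    using A'(1) B'' weakening2 weakening2_under v by (intro tm_Pair)
  then have "?\<Delta> \<turnstile> ?p' \<^bold>: Sig (wk (wk A)) (wk2_under B)" using S by (meson tm_conv eqty_sym)
  then have s': "is_sub ?\<Delta> (cons_sub ?p' (\<lambda>n. Var (n + 2))) (Sig A B # \<Gamma>)"
    by (intro is_sub_cons is_sub_Var_add2) (simp only: sub_Sig_add2)
  have "eq_sub ?\<Delta> (cons_sub ?p (\<lambda>n. Var (n + 2))) (cons_sub ?p' (\<lambda>n. Var (n + 2))) (Sig A B # \<Gamma>)"
    unfolding eq_sub_def
  proof (intro conjI pair_sub s' allI impI)
    fix n assume n: "n < length (Sig A B # \<Gamma>)"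
    show "?\<Delta> \<turnstile> cons_sub ?p (\<lambda>n. Var (n + 2)) n \<doteq> cons_sub ?p' (\<lambda>n. Var (n + 2)) n \<^bold>:
        sub (cons_sub ?p (\<lambda>n. Var (n + 2))) (var_ty (Sig A B # \<Gamma>) n)"
    proof (cases n)
      case 0
      then show ?thesis
        using e by (simp only: cons_sub_simps var_ty_Cons sub_ren sub_Sig_add2)
    next
      case (Suc m)
      then show ?thesis using pair_sub n unfolding is_sub_def by (metis cons_sub_simps(2) eq_refl)
    qed
  qed
  with functionality(2)[OF C(1)] have
    "?\<Delta> \<turnstile> pair_inst A B C \<doteq> sub (cons_sub ?p' (\<lambda>n. Var (n + 2))) C \<^bold>t\<^bold>y\<^bold>p\<^bold>e"
    unfolding pair_inst_def by blast
  then show ?thesis using substitution(2)[OF s' C(2)] unfolding pair_inst_def by (rule eqty_trans)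
qed

end

text \<open>Congruence rules type the primed components in contexts and at types built from the
  unprimed ones. Where these differ, the right-hand side is typed by context conversion and
  functionality, and its type is converted back.\<close>

lemma presupposition:
  "wf_ctx \<Gamma> \<Longrightarrow> True"
  "\<Gamma> \<turnstile> A \<^bold>t\<^bold>y\<^bold>p\<^bold>e \<Longrightarrow> True"
  "\<Gamma> \<turnstile> A \<doteq> B \<^bold>t\<^bold>y\<^bold>p\<^bold>e \<Longrightarrow> \<Gamma> \<turnstile> A \<^bold>t\<^bold>y\<^bold>p\<^bold>e \<and> \<Gamma> \<turnstile> B \<^bold>t\<^bold>y\<^bold>p\<^bold>e"
  "\<Gamma> \<turnstile> t \<^bold>: A \<Longrightarrow> \<Gamma> \<turnstile> A \<^bold>t\<^bold>y\<^bold>p\<^bold>e"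
  "\<Gamma> \<turnstile> t \<doteq> u \<^bold>: A \<Longrightarrow> \<Gamma> \<turnstile> t \<^bold>: A \<and> \<Gamma> \<turnstile> u \<^bold>: A \<and> \<Gamma> \<turnstile> A \<^bold>t\<^bold>y\<^bold>p\<^bold>e"
proof (induction rule: wf_ctx_is_type_eq_type_has_type_eq_term.inducts)
  case (eqty_Pi \<Gamma> A A' B B')
  then show ?case by (auto intro!: Defs.ty_Pi intro: ctx_conv(1) is_sub_ctx_conv1)
next
  case (eqty_Sig \<Gamma> A A' B B')
  then show ?case by (auto intro!: Defs.ty_Sig intro: ctx_conv(1) is_sub_ctx_conv1)
next
  case (eqty_Id \<Gamma> A A' a a' b b')
  then show ?case by (auto intro!: Defs.ty_Id intro: Defs.tm_conv)
next
  case (tm_Var \<Gamma> n)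
  then show ?case using var_ty_type by (simp add: var_ty_def)
next
  case (tm_App \<Gamma> f A B a)
  then show ?case unfolding inst_def using is_type_PiD substitution(1)[OF inst_sub] by blast
next
  case (tm_SigInd \<Gamma> A B C g p)
  then show ?case unfolding inst_def using substitution(1)[OF inst_sub] by blast
next
  case (tm_J \<Gamma> A a C d b p)
  then show ?case unfolding inst2_def using substitution(1)[OF inst2_sub] by force
next
  case (eq_Pi \<Gamma> A A' B B')
  then show ?case
    by (auto intro!: Defs.tm_Pi intro: ctx_conv(3) is_sub_ctx_conv1 ty_El Defs.eqty_El)
next
  case (eq_Sig \<Gamma> A A' B B')
  then show ?case
    by (auto intro!: Defs.tm_Sig intro: ctx_conv(3) is_sub_ctx_conv1 ty_El Defs.eqty_El)
next
  case (eq_Id \<Gamma> A A' a a' b b')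
  then show ?case by (auto intro!: Defs.tm_Id intro: Defs.tm_conv eqty_El)
next
  case (eq_Lam \<Gamma> A A' b b' B)
  have A': "\<Gamma> \<turnstile> A' \<^bold>t\<^bold>y\<^bold>p\<^bold>e" "A' # \<Gamma> \<turnstile> b' \<^bold>: B"
    using eq_Lam by (auto intro: ctx_conv(3) is_sub_ctx_conv1)
  have "\<Gamma> \<turnstile> Pi A B \<doteq> Pi A' B \<^bold>t\<^bold>y\<^bold>p\<^bold>e" using eq_Lam by (intro Defs.eqty_Pi eqty_refl) auto
  then show ?case
    using eq_Lam A' by (auto intro: Defs.tm_Lam ty_Pi Defs.tm_conv[OF Defs.tm_Lam] eqty_sym)
next
  case (eq_App \<Gamma> f f' A B a a')
  then have B: "A # \<Gamma> \<turnstile> B \<^bold>t\<^bold>y\<^bold>p\<^bold>e" using is_type_PiD by blast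
  have "\<Gamma> \<turnstile> inst B a \<doteq> inst B a' \<^bold>t\<^bold>y\<^bold>p\<^bold>e" using B eq_App by (auto intro: inst_cong)
  moreover have "\<Gamma> \<turnstile> inst B a \<^bold>t\<^bold>y\<^bold>p\<^bold>e"
    unfolding inst_def using substitution(1)[OF inst_sub B] eq_App by blast
  ultimately show ?case using eq_App by (auto intro: Defs.tm_App Defs.tm_conv[OF Defs.tm_App] eqty_sym)
next
  case (eq_Pair \<Gamma> A A' B B' a a' b b')
  have B': "A' # \<Gamma> \<turnstile> B' \<^bold>t\<^bold>y\<^bold>p\<^bold>e" using eq_Pair by (auto intro: ctx_conv(1) is_sub_ctx_conv1)
  have "\<Gamma> \<turnstile> inst B a \<doteq> inst B' a' \<^bold>t\<^bold>y\<^bold>p\<^bold>e" using eq_Pair by (auto intro: inst_type_eq)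
  then have "\<Gamma> \<turnstile> Pair A' B' a' b' \<^bold>: Sig A' B'"
    using eq_Pair B' by (auto intro!: Defs.tm_Pair intro: Defs.tm_conv)
  moreover have "\<Gamma> \<turnstile> Sig A B \<doteq> Sig A' B' \<^bold>t\<^bold>y\<^bold>p\<^bold>e" using eq_Pair by (intro Defs.eqty_Sig) auto
  ultimately show ?case using eq_Pair by (auto intro: Defs.tm_Pair ty_Sig Defs.tm_conv eqty_sym)
next
  case (eq_SigInd \<Gamma> A B A' B' C C' g g' p p')
  have B': "A' # \<Gamma> \<turnstile> B' \<^bold>t\<^bold>y\<^bold>p\<^bold>e" using eq_SigInd by (auto intro: ctx_conv(1) is_sub_ctx_conv1)
  have S: "\<Gamma> \<turnstile> Sig A B \<doteq> Sig A' B' \<^bold>t\<^bold>y\<^bold>p\<^bold>e" using eq_SigInd by (intro Defs.eqty_Sig) auto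
  have S': "\<Gamma> \<turnstile> Sig A' B' \<^bold>t\<^bold>y\<^bold>p\<^bold>e" using eq_SigInd B' by (auto intro: ty_Sig)
  have C': "Sig A' B' # \<Gamma> \<turnstile> C' \<^bold>t\<^bold>y\<^bold>p\<^bold>e" using eq_SigInd ctx_conv(1)[OF is_sub_ctx_conv1[OF S' S]] by blast
  have "B # A # \<Gamma> \<turnstile> pair_inst A B C \<doteq> pair_inst A' B' C' \<^bold>t\<^bold>y\<^bold>p\<^bold>e"
    using eq_SigInd by (intro pair_inst_type_eq) auto
  then have "B # A # \<Gamma> \<turnstile> g' \<^bold>: pair_inst A' B' C'" using eq_SigInd by (auto intro: Defs.tm_conv)
  moreover have "is_sub (B' # A' # \<Gamma>) Var (B # A # \<Gamma>)" using eq_SigInd by (auto intro: is_sub_ctx_conv2)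
  ultimately have "B' # A' # \<Gamma> \<turnstile> g' \<^bold>: pair_inst A' B' C'" by (auto intro: ctx_conv(3))
  then have "\<Gamma> \<turnstile> SigInd A' B' C' g' p' \<^bold>: inst C' p'"
    using eq_SigInd B' C' S by (auto intro!: Defs.tm_SigInd intro: Defs.tm_conv)
  moreover have "\<Gamma> \<turnstile> inst C p \<doteq> inst C' p' \<^bold>t\<^bold>y\<^bold>p\<^bold>e" using eq_SigInd by (auto intro: inst_type_eq)
  moreover have "\<Gamma> \<turnstile> inst C p \<^bold>t\<^bold>y\<^bold>p\<^bold>e"
    unfolding inst_def using eq_SigInd substitution(1)[OF inst_sub] by blast
  ultimately show ?case using eq_SigInd by (auto intro: Defs.tm_SigInd Defs.tm_conv eqty_sym)
next
  case (eq_Refl \<Gamma> A A' a a')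
  have "\<Gamma> \<turnstile> Id A a a \<doteq> Id A' a' a' \<^bold>t\<^bold>y\<^bold>p\<^bold>e" using eq_Refl by (intro Defs.eqty_Id) auto
  then show ?case
    using eq_Refl by (auto intro: Defs.tm_Refl ty_Id Defs.tm_conv eqty_sym)
next
  case (eq_J \<Gamma> A a A' a' C C' d d' b b' p p')
  have C': "Id (wk A') (wk a') (Var 0) # A' # \<Gamma> \<turnstile> C' \<^bold>t\<^bold>y\<^bold>p\<^bold>e"
    using eq_J by (auto intro!: ctx_conv(1)[OF is_sub_path_conv, of _ A A' a a'])
  have a': "\<Gamma> \<turnstile> a' \<^bold>: A'" "\<Gamma> \<turnstile> b' \<^bold>: A'" using eq_J by (auto intro: Defs.tm_conv)
  have p: "\<Gamma> \<turnstile> Id A a b \<doteq> Id A' a' b' \<^bold>t\<^bold>y\<^bold>p\<^bold>e" using eq_J by (intro Defs.eqty_Id) auto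
  have p': "\<Gamma> \<turnstile> Id A a b \<doteq> Id A a b' \<^bold>t\<^bold>y\<^bold>p\<^bold>e" using eq_J by (intro Defs.eqty_Id eqty_refl eq_refl) auto
  have r: "\<Gamma> \<turnstile> Refl A a \<doteq> Refl A' a' \<^bold>: Id A a a" using eq_J by (intro Defs.eq_Refl) auto
  have r1: "\<Gamma> \<turnstile> Id A a a' \<doteq> Id A' a' a' \<^bold>t\<^bold>y\<^bold>p\<^bold>e" "\<Gamma> \<turnstile> Refl A' a' \<^bold>: Id A' a' a'"
    using eq_J a' by (auto intro!: Defs.eqty_Id Defs.tm_Refl intro: eq_refl)
  \<comment> \<open>\<open>inst2_type_eq\<close> asks for a path starting at \<open>a\<close>, but
    \<open>Refl A' a'\<close> is first typed as a path from \<open>a'\<close> to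
    \<open>a'\<close>.\<close>
  then have r2: "\<Gamma> \<turnstile> Refl A' a' \<^bold>: Id A a a'" by (meson Defs.tm_conv eqty_sym)
  have "\<Gamma> \<turnstile> inst2 C a (Refl A a) \<doteq> inst2 C' a' (Refl A' a') \<^bold>t\<^bold>y\<^bold>p\<^bold>e"
    using eq_J r r2 by (intro inst2_type_eq[of A a]) (auto intro: Defs.tm_Refl)
  then have "\<Gamma> \<turnstile> J A' a' C' d' b' p' \<^bold>: inst2 C' b' p'"
    using eq_J C' a' p by (auto intro!: Defs.tm_J intro: Defs.tm_conv)
  moreover have "\<Gamma> \<turnstile> inst2 C b p \<doteq> inst2 C' b' p' \<^bold>t\<^bold>y\<^bold>p\<^bold>e"
    using eq_J p' by (intro inst2_type_eq[of A a]) (auto intro: Defs.tm_conv)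
  moreover have "\<Gamma> \<turnstile> inst2 C b p \<^bold>t\<^bold>y\<^bold>p\<^bold>e"
    unfolding inst2_def using eq_J substitution(1)[OF inst2_sub] by force
  ultimately show ?case using eq_J by (auto intro: Defs.tm_J Defs.tm_conv eqty_sym)
next
  case (Pi_beta \<Gamma> A b B a)
  then show ?case
    using substitution(1,3)[OF inst_sub] by (auto simp: inst_def intro: Defs.tm_App[unfolded inst_def] Defs.tm_Lam)
next
  case (Pi_eta \<Gamma> f A B)
  then have A: "\<Gamma> \<turnstile> A \<^bold>t\<^bold>y\<^bold>p\<^bold>e" using is_type_PiD by blast
  from Defs.tm_App[OF weakening(3)[OF A Pi_eta.hyps, unfolded ren.simps] tm_Var0[OF A]]
  show ?case using A Pi_eta by (auto intro: Defs.tm_Lam)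
next
  case (Sig_beta \<Gamma> A B C g a b)
  have "\<Gamma> \<turnstile> inst2 g a b \<^bold>: inst C (Pair A B a b)"
    using substitution(3)[OF inst2_sub[OF Sig_beta.hyps(5,6)] Sig_beta.hyps(4)]
    by (simp only: inst2_pair_inst flip: inst2_def)
  moreover have P: "\<Gamma> \<turnstile> Pair A B a b \<^bold>: Sig A B" using Sig_beta by (intro Defs.tm_Pair)
  ultimately show ?case
    using Sig_beta substitution(1)[OF inst_sub[OF P]]
    by (auto simp: inst_def intro: Defs.tm_SigInd[unfolded inst_def])
next
  case (Id_beta \<Gamma> A a C d)
  then show ?case by (auto intro: Defs.tm_J Defs.tm_Refl)
qed (auto intro: wf_ctx_is_type_eq_type_has_type_eq_term.intros)

section \<open>A sound type checker\<close>

abbreviation obind :: "'a option \<Rightarrow> ('a \<Rightarrow> 'b option) \<Rightarrow> 'b option" (infixl "\<bind>" 54) where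
  "x \<bind> f \<equiv> case_option None f x"

definition as_type :: "(tm option \<times> tm) option \<Rightarrow> tm option" where
  "as_type r = r \<bind> (\<lambda>(s, A). if s = None \<or> s = Some \<U> then Some A else None)"

definition as_term :: "tm \<Rightarrow> (tm option \<times> tm) option \<Rightarrow> tm option" where
  "as_term A r = r \<bind> (\<lambda>(s, t). if s = Some A then Some t else None)"

definition dest_Pi :: "tm option \<Rightarrow> (tm \<times> tm) option" where
  "dest_Pi s = s \<bind> (\<lambda>T. case T of Pi A B \<Rightarrow> Some (A, B) | _ \<Rightarrow> None)"

definition dest_Lam :: "tm \<Rightarrow> tm option" where
  "dest_Lam t = (case t of Lam A b \<Rightarrow> Some b | _ \<Rightarrow> None)"

definition dest_Pair :: "tm \<Rightarrow> (tm \<times> tm) option" where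
  "dest_Pair t = (case t of Pair A B a b \<Rightarrow> Some (a, b) | _ \<Rightarrow> None)"

text \<open>
  \<open>f\<close> does not mention index 0 iff weakening undoes the substitution of an arbitrary term for it.
\<close>

definition eta_head :: "tm \<Rightarrow> tm option" where
  "eta_head b = (case b of
     App f x \<Rightarrow> if x = Var 0 \<and> wk (inst f \<U>) = f then Some (inst f \<U>) else None
   | _ \<Rightarrow> None)"

text \<open>
  \<open>nf k \<Gamma> t\<close> computes with fuel \<open>k\<close>. The result \<open>Some (Some T, t')\<close> means that \<open>t\<close> has the normal type
  \<open>T\<close> and the normal form \<open>t'\<close>, and \<open>Some (None, t')\<close> that \<open>t\<close> is a type with normal form \<open>t'\<close> for
  which no membership in \<open>\<U>\<close> was found. Types are compared syntactically after normalisation.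
\<close>

fun nf :: "nat \<Rightarrow> ctx \<Rightarrow> tm \<Rightarrow> (tm option \<times> tm) option" where
  "nf 0 \<Gamma> t = None"
| "nf (Suc k) \<Gamma> (Var n) =
     (if n < length \<Gamma> then Some (Some (ren (\<lambda>m. m + Suc n) (\<Gamma> ! n)), Var n) else None)"
| "nf (Suc k) \<Gamma> \<U> = Some (None, \<U>)"
| "nf (Suc k) \<Gamma> (Pi A B) =
     nf k \<Gamma> A \<bind> (\<lambda>(s, A').
     if s = None \<or> s = Some \<U> then
       nf k (A' # \<Gamma>) B \<bind> (\<lambda>(s', B').
       if s' = None \<or> s' = Some \<U> then Some (if s = None then None else s', Pi A' B') else None)
     else None)"
| "nf (Suc k) \<Gamma> (Sig A B) =
     nf k \<Gamma> A \<bind> (\<lambda>(s, A').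
     if s = None \<or> s = Some \<U> then
       nf k (A' # \<Gamma>) B \<bind> (\<lambda>(s', B').
       if s' = None \<or> s' = Some \<U> then Some (if s = None then None else s', Sig A' B') else None)
     else None)"
| "nf (Suc k) \<Gamma> (Id A a b) =
     nf k \<Gamma> A \<bind> (\<lambda>(s, A').
     if s = None \<or> s = Some \<U> then
       as_term A' (nf k \<Gamma> a) \<bind> (\<lambda>a'.
       as_term A' (nf k \<Gamma> b) \<bind> (\<lambda>b'. Some (s, Id A' a' b')))
     else None)"
| "nf (Suc k) \<Gamma> (Lam A b) =
     as_type (nf k \<Gamma> A) \<bind> (\<lambda>A'.
     nf k (A' # \<Gamma>) b \<bind> (\<lambda>(s, b').
     s \<bind> (\<lambda>B.
     case eta_head b' \<bind> (\<lambda>f. as_term (Pi A' B) (nf k \<Gamma> f)) of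
       Some f \<Rightarrow> Some (Some (Pi A' B), f)
     | None \<Rightarrow> Some (Some (Pi A' B), Lam A' b'))))"
| "nf (Suc k) \<Gamma> (App f a) =
     nf k \<Gamma> f \<bind> (\<lambda>(s, f').
     dest_Pi s \<bind> (\<lambda>(A, B).
     as_term A (nf k \<Gamma> a) \<bind> (\<lambda>a'.
     as_type (nf k \<Gamma> (inst B a')) \<bind> (\<lambda>T.
     case dest_Lam f' of
       None \<Rightarrow> Some (Some T, App f' a')
     | Some b \<Rightarrow> as_term T (nf k \<Gamma> (inst b a')) \<bind> (\<lambda>t. Some (Some T, t))))))"
| "nf (Suc k) \<Gamma> (Pair A B a b) =
     as_type (nf k \<Gamma> A) \<bind> (\<lambda>A'.
     as_type (nf k (A' # \<Gamma>) B) \<bind> (\<lambda>B'.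
     as_term A' (nf k \<Gamma> a) \<bind> (\<lambda>a'.
     as_type (nf k \<Gamma> (inst B' a')) \<bind> (\<lambda>T.
     as_term T (nf k \<Gamma> b) \<bind> (\<lambda>b'.
     Some (Some (Sig A' B'), Pair A' B' a' b'))))))"
| "nf (Suc k) \<Gamma> (SigInd A B C g p) =
     as_type (nf k \<Gamma> A) \<bind> (\<lambda>A'.
     as_type (nf k (A' # \<Gamma>) B) \<bind> (\<lambda>B'.
     as_type (nf k (Sig A' B' # \<Gamma>) C) \<bind> (\<lambda>C'.
     as_type (nf k (B' # A' # \<Gamma>) (pair_inst A' B' C')) \<bind> (\<lambda>G.
     as_term G (nf k (B' # A' # \<Gamma>) g) \<bind> (\<lambda>g'.
     as_term (Sig A' B') (nf k \<Gamma> p) \<bind> (\<lambda>p'.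
     as_type (nf k \<Gamma> (inst C' p')) \<bind> (\<lambda>T.
     case dest_Pair p' of
       None \<Rightarrow> Some (Some T, SigInd A' B' C' g' p')
     | Some (a, b) \<Rightarrow> as_term T (nf k \<Gamma> (inst2 g' a b)) \<bind> (\<lambda>t. Some (Some T, t)))))))))"
| "nf (Suc k) \<Gamma> (Refl A a) =
     as_type (nf k \<Gamma> A) \<bind> (\<lambda>A'.
     as_term A' (nf k \<Gamma> a) \<bind> (\<lambda>a'. Some (Some (Id A' a' a'), Refl A' a')))"
| "nf (Suc k) \<Gamma> (J A a C d b p) =
     as_type (nf k \<Gamma> A) \<bind> (\<lambda>A'.
     as_term A' (nf k \<Gamma> a) \<bind> (\<lambda>a'.
     as_type (nf k (Id (wk A') (wk a') (Var 0) # A' # \<Gamma>) C) \<bind> (\<lambda>C'.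
     as_type (nf k \<Gamma> (inst2 C' a' (Refl A' a'))) \<bind> (\<lambda>D.
     as_term D (nf k \<Gamma> d) \<bind> (\<lambda>d'.
     as_term A' (nf k \<Gamma> b) \<bind> (\<lambda>b'.
     as_term (Id A' a' b') (nf k \<Gamma> p) \<bind> (\<lambda>p'.
     if b' = a' \<and> p' = Refl A' a' then Some (Some D, d')
     else as_type (nf k \<Gamma> (inst2 C' b' p')) \<bind> (\<lambda>T.
       Some (Some T, J A' a' C' d' b' p')))))))))"

text \<open>
  The soundness of a \<open>\<beta>\<close>-step needs the typing of the body of the \<open>\<lambda>\<close>-abstraction. Extracting it from
  the typing of the abstraction would require injectivity of \<open>Pi\<close>, so it is part of the invariant;
  similarly for pairs.
\<close>

definition canonical :: "ctx \<Rightarrow> tm \<Rightarrow> tm \<Rightarrow> bool" where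
  "canonical \<Gamma> t T \<longleftrightarrow>
     (\<forall>A b. t = Lam A b \<longrightarrow> (\<exists>B. T = Pi A B \<and> A # \<Gamma> \<turnstile> b \<^bold>: B)) \<and>
     (\<forall>A B a b. t = Pair A B a b \<longrightarrow> T = Sig A B \<and> \<Gamma> \<turnstile> a \<^bold>: A \<and> \<Gamma> \<turnstile> b \<^bold>: inst B a)"

text \<open>\<open>None\<close> carries no information, so soundness requires neither enough fuel
  nor completeness of the checker.\<close>

definition sound :: "ctx \<Rightarrow> tm \<Rightarrow> (tm option \<times> tm) option \<Rightarrow> bool" where
  "sound \<Gamma> t r \<longleftrightarrow>
     (\<forall>t'. r = Some (None, t') \<longrightarrow> \<Gamma> \<turnstile> t' \<doteq> t \<^bold>t\<^bold>y\<^bold>p\<^bold>e) \<and>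
     (\<forall>T t'. r = Some (Some T, t') \<longrightarrow> \<Gamma> \<turnstile> t' \<doteq> t \<^bold>: T \<and> canonical \<Gamma> t' T)"

lemma sound_simps [simp]:
  "sound \<Gamma> t None"
  "sound \<Gamma> t (Some (None, t')) \<longleftrightarrow> \<Gamma> \<turnstile> t' \<doteq> t \<^bold>t\<^bold>y\<^bold>p\<^bold>e"
  "sound \<Gamma> t (Some (Some T, t')) \<longleftrightarrow> \<Gamma> \<turnstile> t' \<doteq> t \<^bold>: T \<and> canonical \<Gamma> t' T"
  by (auto simp: sound_def)

lemma sound_bind: "(\<And>y. x = Some y \<Longrightarrow> sound \<Gamma> t (f y)) \<Longrightarrow> sound \<Gamma> t (x \<bind> f)"
  by (cases x) simp_all

lemma sound_sortD:
  "sound \<Gamma> A (Some (s, A')) \<Longrightarrow> s = None \<or> s = Some \<U> \<Longrightarrow> \<Gamma> \<turnstile> A' \<doteq> A \<^bold>t\<^bold>y\<^bold>p\<^bold>e"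
  by (auto intro: eqty_El)

lemma as_typeD: "as_type r = Some A' \<Longrightarrow> sound \<Gamma> A r \<Longrightarrow> \<Gamma> \<turnstile> A' \<doteq> A \<^bold>t\<^bold>y\<^bold>p\<^bold>e"
  by (auto simp: as_type_def eqty_El split: option.splits if_splits)

lemma as_termD: "as_term T r = Some t' \<Longrightarrow> sound \<Gamma> t r \<Longrightarrow> \<Gamma> \<turnstile> t' \<doteq> t \<^bold>: T \<and> canonical \<Gamma> t' T"
  by (auto simp: as_term_def split: option.splits if_splits)

lemma canonical_simps [simp]:
  "canonical \<Gamma> (Var n) T" "canonical \<Gamma> (Pi A B) T" "canonical \<Gamma> (Sig A B) T" "canonical \<Gamma> (Id A a b) T"
  "canonical \<Gamma> (App f a) T" "canonical \<Gamma> (SigInd A B C g p) T" "canonical \<Gamma> (Refl A a) T"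
  "canonical \<Gamma> (J A a C d b p) T"
  "canonical \<Gamma> (Lam A b) (Pi A' B) \<longleftrightarrow> A' = A \<and> A # \<Gamma> \<turnstile> b \<^bold>: B"
  by (auto simp: canonical_def)

lemma dest_PiD: "dest_Pi s = Some (A, B) \<Longrightarrow> s = Some (Pi A B)"
  by (auto simp: dest_Pi_def split: option.splits tm.splits)

lemma dest_LamD: "dest_Lam f = Some b \<Longrightarrow> canonical \<Gamma> f (Pi A B) \<Longrightarrow> f = Lam A b \<and> A # \<Gamma> \<turnstile> b \<^bold>: B"
  by (auto simp: dest_Lam_def split: tm.splits)

lemma dest_PairD:
  "dest_Pair p = Some (a, b) \<Longrightarrow> canonical \<Gamma> p (Sig A B) \<Longrightarrow>
   p = Pair A B a b \<and> \<Gamma> \<turnstile> a \<^bold>: A \<and> \<Gamma> \<turnstile> b \<^bold>: inst B a"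
  by (auto simp: dest_Pair_def canonical_def split: tm.splits)

lemma eta_headD: "eta_head b = Some f \<Longrightarrow> b = App (wk f) (Var 0)"
  by (auto simp: eta_head_def split: tm.splits if_splits)

text \<open>The induction is on fuel because \<open>nf\<close> also recurses into instances such as
  \<open>inst b a'\<close>, which are not subterms. Besides \<open>canonical\<close> only equality
  with the input is maintained; \<open>presupposition\<close> recovers the typing of the normal
  form.\<close>

lemma nf_sound: "wf_ctx \<Gamma> \<Longrightarrow> sound \<Gamma> t (nf k \<Gamma> t)"
proof (induction k arbitrary: \<Gamma> t)
  case 0
  then show ?case by simp
next
  case (Suc k)
  have ty: "\<Gamma> \<turnstile> A' \<doteq> A \<^bold>t\<^bold>y\<^bold>p\<^bold>e" "\<Gamma> \<turnstile> A' \<^bold>t\<^bold>y\<^bold>p\<^bold>e" if "as_type (nf k \<Gamma> A) = Some A'" "wf_ctx \<Gamma>" for \<Gamma> A A'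
    using as_typeD[OF that(1) Suc.IH[OF that(2)]] presupposition(3) by blast+
  have tm: "\<Gamma> \<turnstile> t' \<doteq> t \<^bold>: T" "\<Gamma> \<turnstile> t' \<^bold>: T" "canonical \<Gamma> t' T"
    if "as_term T (nf k \<Gamma> t) = Some t'" "wf_ctx \<Gamma>" for \<Gamma> T t t'
    using as_termD[OF that(1) Suc.IH[OF that(2)]] presupposition(5) by blast+
  have sort: "\<Gamma> \<turnstile> A' \<doteq> A \<^bold>t\<^bold>y\<^bold>p\<^bold>e" "\<Gamma> \<turnstile> A' \<^bold>t\<^bold>y\<^bold>p\<^bold>e" "s = Some \<U> \<Longrightarrow> \<Gamma> \<turnstile> A' \<doteq> A \<^bold>: \<U> \<and> \<Gamma> \<turnstile> A' \<^bold>: \<U>"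
    if "nf k \<Gamma> A = Some (s, A')" "s = None \<or> s = Some \<U>" "wf_ctx \<Gamma>" for \<Gamma> A A' s
    using sound_sortD[of \<Gamma> A s A'] Suc.IH[OF that(3), of A] that(1,2) presupposition(3,5) by auto
  show ?case
  proof (cases t)
    case (Var n)
    then show ?thesis using Suc.prems tm_Var[of \<Gamma> n] by (auto intro: eq_refl)
  next
    case \<U>
    then show ?thesis using Suc.prems by (auto intro: eqty_refl ty_U)
  next
    case (Pi A B)
    show ?thesis unfolding Pi nf.simps
    proof (intro sound_bind, clarify)
      fix s A'
      assume A: "nf k \<Gamma> A = Some (s, A')"
      show "sound \<Gamma> (Pi A B) (if s = None \<or> s = Some \<U> then
          nf k (A' # \<Gamma>) B \<bind> (\<lambda>(s', B'). if s' = None \<or> s' = Some \<U>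
            then Some (if s = None then None else s', Pi A' B') else None) else None)"
      proof (cases "s = None \<or> s = Some \<U>")
        case True
        note A = sort[OF A True Suc.prems]
        note B = sort[OF _ _ ctx_Cons[OF Suc.prems A(2)]]
        show ?thesis using True A B by (auto intro!: sound_bind eqty_Pi eq_Pi)
      qed auto
    qed
  next
    case (Sig A B)
    show ?thesis unfolding Sig nf.simps
    proof (intro sound_bind, clarify)
      fix s A'
      assume A: "nf k \<Gamma> A = Some (s, A')"
      show "sound \<Gamma> (Sig A B) (if s = None \<or> s = Some \<U> then
          nf k (A' # \<Gamma>) B \<bind> (\<lambda>(s', B'). if s' = None \<or> s' = Some \<U>
            then Some (if s = None then None else s', Sig A' B') else None) else None)"
      proof (cases "s = None \<or> s = Some \<U>")
        case True
        note A = sort[OF A True Suc.prems]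
        note B = sort[OF _ _ ctx_Cons[OF Suc.prems A(2)]]
        show ?thesis using True A B by (auto intro!: sound_bind eqty_Sig eq_Sig)
      qed auto
    qed
  next
    case (Id A a b)
    show ?thesis unfolding Id nf.simps
    proof (intro sound_bind, clarify)
      fix s A'
      assume A: "nf k \<Gamma> A = Some (s, A')"
      show "sound \<Gamma> (Id A a b) (if s = None \<or> s = Some \<U> then
          as_term A' (nf k \<Gamma> a) \<bind> (\<lambda>a'. as_term A' (nf k \<Gamma> b) \<bind> (\<lambda>b'. Some (s, Id A' a' b')))
          else None)"
      proof (cases "s = None \<or> s = Some \<U>")
        case True
        then show ?thesis
          using sort[OF A True Suc.prems] tm[OF _ Suc.prems]
          by (auto intro!: sound_bind eqty_Id eq_Id)
      qed auto
    qed
  next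
    case (Lam A b)
    show ?thesis unfolding Lam nf.simps
    proof (intro sound_bind, clarify, intro sound_bind)
      fix A' s b' B
      assume A: "as_type (nf k \<Gamma> A) = Some A'" and b: "nf k (A' # \<Gamma>) b = Some (s, b')"
        and s: "s = Some B"
      note A = ty[OF A Suc.prems]
      have "A' # \<Gamma> \<turnstile> b' \<doteq> b \<^bold>: B"
        using Suc.IH[OF ctx_Cons[OF Suc.prems A(2)], of b] b s by simp
      then have L: "\<Gamma> \<turnstile> Lam A' b' \<doteq> Lam A b \<^bold>: Pi A' B" and b': "A' # \<Gamma> \<turnstile> b' \<^bold>: B"
        using A presupposition(5) by (auto intro: eq_Lam)
      show "sound \<Gamma> (Lam A b) (case eta_head b' \<bind> (\<lambda>f. as_term (Pi A' B) (nf k \<Gamma> f)) of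
          None \<Rightarrow> Some (Some (Pi A' B), Lam A' b') | Some f \<Rightarrow> Some (Some (Pi A' B), f))"
      proof (cases "eta_head b' \<bind> (\<lambda>f. as_term (Pi A' B) (nf k \<Gamma> f))")
        case None
        then show ?thesis using L b' by simp
      next
        case (Some f')
        then obtain f where f: "eta_head b' = Some f" "as_term (Pi A' B) (nf k \<Gamma> f) = Some f'"
          by (auto split: option.splits)
        note f' = tm[OF f(2) Suc.prems]
        \<comment> \<open>The checker normalises \<open>f\<close> again in \<Gamma>, so its typing
          follows from \<open>presupposition\<close> and no strengthening of the typing of
          \<open>wk f\<close> is involved.\<close>
        have "\<Gamma> \<turnstile> f \<^bold>: Pi A' B" using f'(1) presupposition(5) by blast
        then have "\<Gamma> \<turnstile> Lam A' b' \<doteq> f \<^bold>: Pi A' B" using Pi_eta eta_headD[OF f(1)] by blast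
        with f' L have "\<Gamma> \<turnstile> f' \<doteq> Lam A b \<^bold>: Pi A' B" by (meson eq_trans eq_sym)
        then show ?thesis using Some f' by simp
      qed
    qed
  next
    case (App f a)
    show ?thesis unfolding App nf.simps
    proof (intro sound_bind, clarify, intro sound_bind, clarify, intro sound_bind)
      fix s f' A B a' T
      assume f: "nf k \<Gamma> f = Some (s, f')" and s: "dest_Pi s = Some (A, B)"
        and a: "as_term A (nf k \<Gamma> a) = Some a'" and T: "as_type (nf k \<Gamma> (inst B a')) = Some T"
      have f: "\<Gamma> \<turnstile> f' \<doteq> f \<^bold>: Pi A B" "canonical \<Gamma> f' (Pi A B)"
        using Suc.IH[OF Suc.prems, of f] f dest_PiD[OF s] by simp_all
      note a = tm[OF a Suc.prems] and T = ty[OF T Suc.prems]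
      have e: "\<Gamma> \<turnstile> App f' a' \<doteq> App f a \<^bold>: T" using f a T by (meson eq_App eq_conv eqty_sym)
      show "sound \<Gamma> (App f a) (case dest_Lam f' of None \<Rightarrow> Some (Some T, App f' a')
         | Some b \<Rightarrow> as_term T (nf k \<Gamma> (inst b a')) \<bind> (\<lambda>t. Some (Some T, t)))"
      proof (cases "dest_Lam f'")
        case None
        then show ?thesis using e by simp
      next
        case (Some b)
        note L = dest_LamD[OF Some f(2)]
        have "\<Gamma> \<turnstile> Pi A B \<^bold>t\<^bold>y\<^bold>p\<^bold>e" using f(1) presupposition(5) by blast
        then have "\<Gamma> \<turnstile> App f' a' \<doteq> inst b a' \<^bold>: inst B a'"
          using L a(2) Pi_beta[of \<Gamma> A b B a'] is_type_PiD by blast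
        then have "\<Gamma> \<turnstile> inst b a' \<doteq> App f a \<^bold>: T" using e T by (meson eq_trans eq_sym eq_conv eqty_sym)
        then show ?thesis
          using Some tm[OF _ Suc.prems, of T "inst b a'"] by (auto intro!: sound_bind intro: eq_trans)
      qed
    qed
  next
    case (Pair A B a b)
    show ?thesis unfolding Pair nf.simps
    proof (intro sound_bind)
      fix A' B' a' T b'
      assume A: "as_type (nf k \<Gamma> A) = Some A'" and B: "as_type (nf k (A' # \<Gamma>) B) = Some B'"
        and a: "as_term A' (nf k \<Gamma> a) = Some a'" and T: "as_type (nf k \<Gamma> (inst B' a')) = Some T"
        and b: "as_term T (nf k \<Gamma> b) = Some b'"
      note A = ty[OF A Suc.prems]
      note B = ty[OF B ctx_Cons[OF Suc.prems A(2)]]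
      note a = tm[OF a Suc.prems] and T = ty[OF T Suc.prems] and b = tm[OF b Suc.prems]
      have "\<Gamma> \<turnstile> b' \<doteq> b \<^bold>: inst B' a'" "\<Gamma> \<turnstile> b' \<^bold>: inst B' a'"
        using b T by (auto intro: eq_conv tm_conv)
      then show "sound \<Gamma> (Pair A B a b) (Some (Some (Sig A' B'), Pair A' B' a' b'))"
        using A B a by (auto simp: canonical_def intro: eq_Pair)
    qed
  next
    case (SigInd A B C g p)
    show ?thesis unfolding SigInd nf.simps
    proof (intro sound_bind)
      fix A' B' C' G g' p' T
      assume A: "as_type (nf k \<Gamma> A) = Some A'" and B: "as_type (nf k (A' # \<Gamma>) B) = Some B'"
        and C: "as_type (nf k (Sig A' B' # \<Gamma>) C) = Some C'"
        and G: "as_type (nf k (B' # A' # \<Gamma>) (pair_inst A' B' C')) = Some G"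
        and g: "as_term G (nf k (B' # A' # \<Gamma>) g) = Some g'"
        and p: "as_term (Sig A' B') (nf k \<Gamma> p) = Some p'"
        and T: "as_type (nf k \<Gamma> (inst C' p')) = Some T"
      note A = ty[OF A Suc.prems]
      note wA = ctx_Cons[OF Suc.prems A(2)]
      note B = ty[OF B wA]
      note C = ty[OF C ctx_Cons[OF Suc.prems ty_Sig[OF A(2) B(2)]]]
      note G = ty[OF G ctx_Cons[OF wA B(2)]] and g = tm[OF g ctx_Cons[OF wA B(2)]]
      note p = tm[OF p Suc.prems] and T = ty[OF T Suc.prems]
      have g': "B' # A' # \<Gamma> \<turnstile> g' \<doteq> g \<^bold>: pair_inst A' B' C'" "B' # A' # \<Gamma> \<turnstile> g' \<^bold>: pair_inst A' B' C'"
        using g G by (auto intro: eq_conv tm_conv)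
      have e: "\<Gamma> \<turnstile> SigInd A' B' C' g' p' \<doteq> SigInd A B C g p \<^bold>: T"
        using eq_SigInd[OF A(2) B(2) A(1) B(1) C(1) g'(1) p(1)] T by (meson eq_conv eqty_sym)
      show "sound \<Gamma> (SigInd A B C g p) (case dest_Pair p' of None \<Rightarrow> Some (Some T, SigInd A' B' C' g' p')
         | Some (a, b) \<Rightarrow> as_term T (nf k \<Gamma> (inst2 g' a b)) \<bind> (\<lambda>t. Some (Some T, t)))"
      proof (cases "dest_Pair p'")
        case None
        then show ?thesis using e by simp
      next
        case (Some ab)
        obtain a b where ab: "ab = (a, b)" by fastforce
        note P = dest_PairD[OF Some[unfolded ab] p(3)]
        have "\<Gamma> \<turnstile> SigInd A' B' C' g' p' \<doteq> inst2 g' a b \<^bold>: inst C' p'"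
          using P Sig_beta[OF A(2) B(2) C(2) g'(2)] by blast
        then have "\<Gamma> \<turnstile> inst2 g' a b \<doteq> SigInd A B C g p \<^bold>: T"
          using e T by (meson eq_trans eq_sym eq_conv eqty_sym)
        then show ?thesis
          using Some ab tm[OF _ Suc.prems, of T "inst2 g' a b"]
          by (auto intro!: sound_bind intro: eq_trans)
      qed
    qed
  next
    case (Refl A a)
    show ?thesis unfolding Refl nf.simps
    proof (intro sound_bind)
      fix A' a'
      assume A: "as_type (nf k \<Gamma> A) = Some A'" and a: "as_term A' (nf k \<Gamma> a) = Some a'"
      show "sound \<Gamma> (Refl A a) (Some (Some (Id A' a' a'), Refl A' a'))"
        using ty[OF A Suc.prems] tm[OF a Suc.prems] by (auto intro: eq_Refl)
    qed
  next
    case (J A a C d b p)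
    show ?thesis unfolding J nf.simps
    proof (intro sound_bind)
      fix A' a' C' D d' b' p'
      assume A: "as_type (nf k \<Gamma> A) = Some A'" and a: "as_term A' (nf k \<Gamma> a) = Some a'"
        and C: "as_type (nf k (Id (wk A') (wk a') (Var 0) # A' # \<Gamma>) C) = Some C'"
        and D: "as_type (nf k \<Gamma> (inst2 C' a' (Refl A' a'))) = Some D"
        and d: "as_term D (nf k \<Gamma> d) = Some d'"
        and b: "as_term A' (nf k \<Gamma> b) = Some b'" and p: "as_term (Id A' a' b') (nf k \<Gamma> p) = Some p'"
      note A = ty[OF A Suc.prems] and a = tm[OF a Suc.prems] and D = ty[OF D Suc.prems]
      note C = ty[OF C ctx_Cons[OF ctx_Cons[OF Suc.prems A(2)] path_ctx[OF A(2) a(2)]]]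
      note d = tm[OF d Suc.prems] and b = tm[OF b Suc.prems] and p = tm[OF p Suc.prems]
      have d': "\<Gamma> \<turnstile> d' \<doteq> d \<^bold>: inst2 C' a' (Refl A' a')" "\<Gamma> \<turnstile> d' \<^bold>: inst2 C' a' (Refl A' a')"
        using d D by (auto intro: eq_conv tm_conv)
      have e: "\<Gamma> \<turnstile> J A' a' C' d' b' p' \<doteq> J A a C d b p \<^bold>: inst2 C' b' p'"
        by (rule eq_J[OF A(2) a(2) A(1) a(1) C(1) d'(1) b(1) p(1)])
      show "sound \<Gamma> (J A a C d b p) (if b' = a' \<and> p' = Refl A' a' then Some (Some D, d')
         else as_type (nf k \<Gamma> (inst2 C' b' p')) \<bind> (\<lambda>T. Some (Some T, J A' a' C' d' b' p')))"
      proof (cases "b' = a' \<and> p' = Refl A' a'")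
        case True
        then have "\<Gamma> \<turnstile> d' \<doteq> J A a C d b p \<^bold>: inst2 C' a' (Refl A' a')"
          using e Id_beta[OF A(2) a(2) C(2) d'(2)] by (meson eq_trans eq_sym)
        then show ?thesis using True d(3) D by (auto intro: eq_conv eqty_sym)
      next
        case False
        then show ?thesis
          using eq_conv[OF e eqty_sym[OF ty(1)[OF _ Suc.prems]]] by (auto intro!: sound_bind)
      qed
    qed
  qed
qed

section \<open>Checking closed terms\<close>

definition checks :: "nat \<Rightarrow> tm \<Rightarrow> tm \<Rightarrow> bool" where
  "checks k t T \<longleftrightarrow> (case as_type (nf k [] T) of None \<Rightarrow> False
     | Some T' \<Rightarrow> (case as_term T' (nf k [] t) of None \<Rightarrow> False | Some _ \<Rightarrow> True))"

lemma checks_sound: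
  assumes "checks k t T"
  shows "[] \<turnstile> t \<^bold>: T"
proof -
  from assms obtain T' t'
    where T': "as_type (nf k [] T) = Some T'" and t': "as_term T' (nf k [] t) = Some t'"
    by (auto simp: checks_def split: option.splits)
  have "[] \<turnstile> T' \<doteq> T \<^bold>t\<^bold>y\<^bold>p\<^bold>e" by (rule as_typeD[OF T' nf_sound[OF ctx_Nil]])
  moreover have "[] \<turnstile> t' \<doteq> t \<^bold>: T'" using as_termD[OF t' nf_sound[OF ctx_Nil]] by blast
  ultimately show ?thesis using presupposition(5) tm_conv by blast
qed

section \<open>Terms with named variables\<close>

text \<open>
  A term with named variables maps the depth of its context to a de Bruijn term, so that HOL
  abstractions serve as binders: the variable introduced at depth \<open>k\<close> has index \<open>m - Suc k\<close> at any
  later depth \<open>m\<close>.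
\<close>

type_synonym named = "nat \<Rightarrow> tm"

definition bound :: "nat \<Rightarrow> named" where "bound k m = Var (m - Suc k)"

definition bind1 :: "(named \<Rightarrow> named) \<Rightarrow> named" where
  "bind1 F k = F (bound k) (Suc k)"

definition bind2 :: "(named \<Rightarrow> named \<Rightarrow> named) \<Rightarrow> named" where
  "bind2 F k = F (bound k) (bound (Suc k)) (Suc (Suc k))"

text \<open>Ignoring the depth is right for closed terms; here these are \<U>,
  \<open>isUnivalent\<close> and \<open>equivs_are_PIE\<close>.\<close>

definition lift0 :: "tm \<Rightarrow> named" where "lift0 t k = t"
definition lift1 :: "(tm \<Rightarrow> tm) \<Rightarrow> named \<Rightarrow> named" where "lift1 F a k = F (a k)"
definition lift2 :: "(tm \<Rightarrow> tm \<Rightarrow> tm) \<Rightarrow> named \<Rightarrow> named \<Rightarrow> named" where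
  "lift2 F a b k = F (a k) (b k)"
definition lift3 :: "(tm \<Rightarrow> tm \<Rightarrow> tm \<Rightarrow> tm) \<Rightarrow> named \<Rightarrow> named \<Rightarrow> named \<Rightarrow> named" where
  "lift3 F a b c k = F (a k) (b k) (c k)"

definition univ :: named where "univ = lift0 \<U>"

definition pi :: "named \<Rightarrow> (named \<Rightarrow> named) \<Rightarrow> named" where "pi A B k = Pi (A k) (bind1 B k)"
definition lam :: "named \<Rightarrow> (named \<Rightarrow> named) \<Rightarrow> named" where "lam A b k = Lam (A k) (bind1 b k)"
definition sig :: "named \<Rightarrow> (named \<Rightarrow> named) \<Rightarrow> named" where "sig A B k = Sig (A k) (bind1 B k)"

abbreviation app (infixl "\<cdot>" 90) where "f \<cdot> a \<equiv> lift2 App f a"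
abbreviation arrow (infixr "\<rightarrow>" 60) where "A \<rightarrow> B \<equiv> lift2 arr A B"
abbreviation "path \<equiv> lift3 Id"
abbreviation "rfl \<equiv> lift2 Refl"

text \<open>
  The annotations of pairs and of their eliminator are read off the \<open>\<Sigma>\<close>-type \<open>S\<close>; for any other \<open>S\<close>
  the result is the junk value \<open>\<U>\<close>, which the checker rejects as a term.
\<close>

definition pair :: "named \<Rightarrow> named \<Rightarrow> named \<Rightarrow> named" where
  "pair S a b k = (case S k of Sig A B \<Rightarrow> Pair A B (a k) (b k) | _ \<Rightarrow> \<U>)"

definition split ::
  "named \<Rightarrow> (named \<Rightarrow> named) \<Rightarrow> (named \<Rightarrow> named \<Rightarrow> named) \<Rightarrow> named \<Rightarrow> named" where
  "split S C g p k =
     (case S k of Sig A B \<Rightarrow> SigInd A B (bind1 C k) (bind2 g k) (p k) | _ \<Rightarrow> \<U>)"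

definition path_ind ::
  "named \<Rightarrow> named \<Rightarrow> (named \<Rightarrow> named \<Rightarrow> named) \<Rightarrow> named \<Rightarrow> named \<Rightarrow> named \<Rightarrow> named" where
  "path_ind A a C d b p k = J (A k) (a k) (bind2 C k) (d k) (b k) (p k)"

abbreviation "Equiv \<equiv> lift2 equiv_ty"
abbreviation "IsEquiv \<equiv> lift3 isEquiv"
abbreviation "IsPIE \<equiv> lift3 isPIE"
abbreviation "Linv \<equiv> lift3 linv"
abbreviation "Rinv \<equiv> lift3 rinv"
abbreviation "idfun \<equiv> lift1 id_fun"
abbreviation "idequiv \<equiv> lift1 id_equiv"
abbreviation "toequiv \<equiv> lift2 idtoequiv"
abbreviation "Path \<equiv> path univ"
abbreviation "to_fun A B p \<equiv> lift2 idtofun A B \<cdot> p"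
abbreviation "to_equiv A B p \<equiv> toequiv A B \<cdot> p"
abbreviation "compose \<equiv> lift3 comp_fun"

definition proj1 :: "named \<Rightarrow> named \<Rightarrow> named \<Rightarrow> named" where
  "proj1 S A p = split S (\<lambda>_. A) (\<lambda>a _. a) p"

section \<open>Inhabited closed types\<close>

definition inhabited :: "named \<Rightarrow> bool" where
  "inhabited T \<longleftrightarrow> (\<exists>t. [] \<turnstile> t \<^bold>: T 0)"

text \<open>The number 40 is fuel for \<open>nf\<close>, enough for all terms below, and depth 0
  yields closed de Bruijn terms. Explicit proof terms are then verified by evaluating the checker
  inside the logic.\<close>

lemma inhabitedI: "checks 40 (t 0) (T 0) \<Longrightarrow> inhabited T"
  unfolding inhabited_def using checks_sound by blast

lemma wk_arr: "wk (arr A B) = arr (wk A) (wk B)"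
  by (simp add: arr_def ren_up_wk)

lemma arr_App: "\<Gamma> \<turnstile> f \<^bold>: arr A B \<Longrightarrow> \<Gamma> \<turnstile> a \<^bold>: A \<Longrightarrow> \<Gamma> \<turnstile> App f a \<^bold>: B"
  unfolding arr_def by (metis tm_App inst_wk)

lemma arr_dom_type: "\<Gamma> \<turnstile> f \<^bold>: arr A B \<Longrightarrow> \<Gamma> \<turnstile> A \<^bold>t\<^bold>y\<^bold>p\<^bold>e"
  unfolding arr_def using presupposition(4) is_type_PiD by blast

lemma arr_App_Var0: "\<Gamma> \<turnstile> f \<^bold>: arr A B \<Longrightarrow> A # \<Gamma> \<turnstile> App (wk f) (Var 0) \<^bold>: wk B"
  using arr_dom_type weakening(3) tm_Var0 arr_App wk_arr by metis

text \<open>Later terms take earlier results as bound variables, so that checking them does not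
  unfold the earlier proofs; the actual inhabitants are supplied by this rule.\<close>

lemma inhabited_mp: "inhabited (S \<rightarrow> T) \<Longrightarrow> inhabited S \<Longrightarrow> inhabited T"
  unfolding inhabited_def lift2_def using arr_App by blast

lemma inhabited_comp:
  assumes "inhabited (B \<rightarrow> C)" "inhabited (A \<rightarrow> B)"
  shows "inhabited (A \<rightarrow> C)"
proof -
  obtain g f where g: "[] \<turnstile> g \<^bold>: arr (B 0) (C 0)" and f: "[] \<turnstile> f \<^bold>: arr (A 0) (B 0)"
    using assms by (auto simp: inhabited_def lift2_def)
  note A = arr_dom_type[OF f]
  from arr_App[OF weakening(3)[OF A g, unfolded wk_arr] arr_App_Var0[OF f]] tm_Lam[OF A]
  show ?thesis unfolding inhabited_def lift2_def arr_def by blast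
qed

text \<open>Application under a common hypothesis \<open>A\<close>, which in the end is
  \<open>equivs_are_PIE\<close>.\<close>

lemma inhabited_mp_under:
  assumes "inhabited (A \<rightarrow> B \<rightarrow> C)" "inhabited (A \<rightarrow> B)"
  shows "inhabited (A \<rightarrow> C)"
proof -
  obtain g f where g: "[] \<turnstile> g \<^bold>: arr (A 0) (arr (B 0) (C 0))" and f: "[] \<turnstile> f \<^bold>: arr (A 0) (B 0)"
    using assms by (auto simp: inhabited_def lift2_def)
  from arr_App[OF arr_App_Var0[OF g, unfolded wk_arr] arr_App_Var0[OF f]] tm_Lam[OF arr_dom_type[OF f]]
  show ?thesis unfolding inhabited_def lift2_def arr_def by blast
qed

section \<open>From univalence to path-induced equivalences\<close>

definition inverse_ty where
  "inverse_ty = pi univ (\<lambda>X. pi X (\<lambda>x. pi X (\<lambda>y. path X x y \<rightarrow> path X y x)))"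

text \<open>\<open>isPIE\<close> gives a path ending at \<open>idtofun p\<close>, whereas the path
  inductions that replace \<open>f\<close> have to start there.\<close>

lemma inverse: "inhabited inverse_ty"
  by (rule inhabitedI[of "lam univ (\<lambda>X. lam X (\<lambda>x. lam X (\<lambda>y. lam (path X x y) (\<lambda>q.
    path_ind X x (\<lambda>y _. path X y x) (rfl X x) y q))))"]) code_simp

definition underlying_ty where
  "underlying_ty = pi univ (\<lambda>A. pi univ (\<lambda>B. pi (Path A B) (\<lambda>p. pi (Equiv A B) (\<lambda>w.
     path (Equiv A B) (to_equiv A B p) w \<rightarrow>
     path (A \<rightarrow> B) (proj1 (Equiv A B) (A \<rightarrow> B) w) (to_fun A B p)))))"

text \<open>The endpoint \<open>w\<close> is kept general so that \<open>q\<close> can be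
  eliminated, turning \<open>w\<close> into \<open>to_equiv A B p\<close>; eliminating
  \<open>p\<close> then makes both sides reduce to the identity of \<open>A\<close>.\<close>

lemma underlying: "inhabited underlying_ty"
  by (rule inhabitedI[of "lam univ (\<lambda>A. lam univ (\<lambda>B. lam (Path A B) (\<lambda>p. lam (Equiv A B) (\<lambda>w.
    lam (path (Equiv A B) (to_equiv A B p) w) (\<lambda>q.
      path_ind (Equiv A B) (to_equiv A B p)
        (\<lambda>w _. path (A \<rightarrow> B) (proj1 (Equiv A B) (A \<rightarrow> B) w) (to_fun A B p))
        (path_ind univ A
          (\<lambda>B p. path (A \<rightarrow> B) (proj1 (Equiv A B) (A \<rightarrow> B) (to_equiv A B p)) (to_fun A B p))
          (rfl (A \<rightarrow> A) (idfun A)) B p) w q)))))"]) code_simp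

text \<open>The composite and the identity in the type of \<epsilon> reduce, and
  \<open>proj1\<close> of the pair reduces to \<open>f\<close>, so \<open>und\<close> yields the
  second component of \<open>IsPIE\<close> without transport.\<close>

lemma PIE_of_univalence:
  "inhabited (underlying_ty \<rightarrow> lift0 isUnivalent \<rightarrow> lift0 equivs_are_PIE)"
  by (rule inhabitedI[of "lam underlying_ty (\<lambda>und. lam (lift0 isUnivalent) (\<lambda>ua.
    lam univ (\<lambda>A. lam univ (\<lambda>B. lam (A \<rightarrow> B) (\<lambda>f. lam (IsEquiv A B f) (\<lambda>e.
      split (IsEquiv (Path A B) (Equiv A B) (toequiv A B)) (\<lambda>_. IsPIE A B f)
        (\<lambda>_ r. split (Rinv (Path A B) (Equiv A B) (toequiv A B)) (\<lambda>_. IsPIE A B f)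
          (\<lambda>h \<epsilon>. pair (IsPIE A B f) (h \<cdot> pair (Equiv A B) f e)
            (und \<cdot> A \<cdot> B \<cdot> (h \<cdot> pair (Equiv A B) f e) \<cdot> pair (Equiv A B) f e \<cdot>
              (\<epsilon> \<cdot> pair (Equiv A B) f e)))
          r)
        (ua \<cdot> A \<cdot> B)))))))"]) code_simp


section \<open>The inverses of \<open>idtoequiv\<close>\<close>

text \<open>\<open>path_diff A B C p q\<close> is \<open>p\<inverse> \<bullet> q\<close>.\<close>

definition path_diff :: "named \<Rightarrow> named \<Rightarrow> named \<Rightarrow> named \<Rightarrow> named \<Rightarrow> named" where
  "path_diff A B C p q =
     path_ind univ A (\<lambda>B _. Path A C \<rightarrow> Path B C) (idfun (Path A C)) B p \<cdot> q"

definition path_diff_self_ty where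
  "path_diff_self_ty = pi univ (\<lambda>A. pi univ (\<lambda>B. pi (Path A B) (\<lambda>p.
     path (Path B B) (path_diff A B B p p) (rfl univ B))))"

lemma path_diff_self: "inhabited path_diff_self_ty"
  by (rule inhabitedI[of "lam univ (\<lambda>A. lam univ (\<lambda>B. lam (Path A B) (\<lambda>p.
    path_ind univ A (\<lambda>B p. path (Path B B) (path_diff A B B p p) (rfl univ B))
      (rfl (Path A A) (rfl univ A)) B p)))"]) code_simp

definition linv_of_map_ty where
  "linv_of_map_ty = pi univ (\<lambda>A. pi (pi univ (\<lambda>B. Equiv A B \<rightarrow> Path A B)) (\<lambda>s. pi univ (\<lambda>B.
     Linv (Path A B) (Equiv A B) (toequiv A B))))"

text \<open>At reflexivity \<open>to_equiv\<close> reduces to \<open>idequiv A\<close>, so both path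
  arguments of \<open>path_diff\<close> become \<open>s \<cdot> A \<cdot> idequiv A\<close> and
  \<open>diff\<close> applies.\<close>

lemma linv_of_map: "inhabited (path_diff_self_ty \<rightarrow> linv_of_map_ty)"
  by (rule inhabitedI[of "lam path_diff_self_ty (\<lambda>diff.
    lam univ (\<lambda>A. lam (pi univ (\<lambda>B. Equiv A B \<rightarrow> Path A B)) (\<lambda>s. lam univ (\<lambda>B.
      pair (Linv (Path A B) (Equiv A B) (toequiv A B))
        (lam (Equiv A B) (\<lambda>w. path_diff A A B (s \<cdot> A \<cdot> idequiv A) (s \<cdot> B \<cdot> w)))
        (lam (Path A B) (\<lambda>p. path_ind univ A
          (\<lambda>B p. path (Path A B)
            (path_diff A A B (s \<cdot> A \<cdot> idequiv A) (s \<cdot> B \<cdot> to_equiv A B p)) p)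
          (diff \<cdot> A \<cdot> A \<cdot> (s \<cdot> A \<cdot> idequiv A)) B p))))))"]) code_simp

section \<open>Equality of equivalences with path-induced underlying functions\<close>

definition loop_equiv_ty where
  "loop_equiv_ty = pi univ (\<lambda>A. pi (IsEquiv A A (idfun A)) (\<lambda>e.
     path (Equiv A A) (idequiv A) (pair (Equiv A A) (idfun A) e)))"

definition equiv_of_path_ty where
  "equiv_of_path_ty = pi univ (\<lambda>A. pi univ (\<lambda>B. pi (Path A B) (\<lambda>p. pi (A \<rightarrow> B) (\<lambda>f.
     path (A \<rightarrow> B) (to_fun A B p) f \<rightarrow> pi (IsEquiv A B f) (\<lambda>e.
       path (Equiv A B) (to_equiv A B p) (pair (Equiv A B) f e))))))"

text \<open>Eliminating \<open>q\<close> first replaces \<open>f\<close> by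
  \<open>to_fun A B p\<close>; \<open>e\<close> is generalised in the motive because its type
  depends on \<open>f\<close>. Eliminating \<open>p\<close> then leaves exactly
  \<open>loop\<close>.\<close>

lemma equiv_of_path: "inhabited (loop_equiv_ty \<rightarrow> equiv_of_path_ty)"
  by (rule inhabitedI[of "lam loop_equiv_ty (\<lambda>loop.
    lam univ (\<lambda>A. lam univ (\<lambda>B. lam (Path A B) (\<lambda>p. lam (A \<rightarrow> B) (\<lambda>f.
      lam (path (A \<rightarrow> B) (to_fun A B p) f) (\<lambda>q.
        path_ind (A \<rightarrow> B) (to_fun A B p)
          (\<lambda>f _. pi (IsEquiv A B f) (\<lambda>e.
            path (Equiv A B) (to_equiv A B p) (pair (Equiv A B) f e)))
          (path_ind univ A
            (\<lambda>B p. pi (IsEquiv A B (to_fun A B p)) (\<lambda>e.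
              path (Equiv A B) (to_equiv A B p) (pair (Equiv A B) (to_fun A B p) e)))
            (loop \<cdot> A) B p) f q))))))"]) code_simp

definition PIE_path :: "named \<Rightarrow> named \<Rightarrow> named \<Rightarrow> named \<Rightarrow> named" where
  "PIE_path A B f z = proj1 (IsPIE A B f) (Path A B) z"

definition equiv_of_PIE_ty where
  "equiv_of_PIE_ty = pi univ (\<lambda>A. pi univ (\<lambda>B. pi (A \<rightarrow> B) (\<lambda>f.
     pi (IsPIE A B f) (\<lambda>z. pi (IsEquiv A B f) (\<lambda>e.
       path (Equiv A B) (to_equiv A B (PIE_path A B f z)) (pair (Equiv A B) f e))))))"

text \<open>\<open>z\<close> is split because \<open>PIE_path\<close> reduces only on pairs. Its
  second component starts at \<open>f\<close> and is reversed to suit \<open>eop\<close>.\<close>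

lemma equiv_of_PIE: "inhabited (inverse_ty \<rightarrow> equiv_of_path_ty \<rightarrow> equiv_of_PIE_ty)"
  by (rule inhabitedI[of "lam inverse_ty (\<lambda>inv. lam equiv_of_path_ty (\<lambda>eop.
    lam univ (\<lambda>A. lam univ (\<lambda>B. lam (A \<rightarrow> B) (\<lambda>f. lam (IsPIE A B f) (\<lambda>z. lam (IsEquiv A B f) (\<lambda>e.
      split (IsPIE A B f)
        (\<lambda>z. path (Equiv A B) (to_equiv A B (PIE_path A B f z)) (pair (Equiv A B) f e))
        (\<lambda>p q. eop \<cdot> A \<cdot> B \<cdot> p \<cdot> f \<cdot> (inv \<cdot> (A \<rightarrow> B) \<cdot> f \<cdot> to_fun A B p \<cdot> q) \<cdot> e) z)))))))"]) code_simp

definition equivtoid :: "named \<Rightarrow> named \<Rightarrow> named" where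
  "equivtoid H A = lam univ (\<lambda>B. lam (Equiv A B) (\<lambda>w.
     split (Equiv A B) (\<lambda>_. Path A B) (\<lambda>f e. PIE_path A B f (H \<cdot> A \<cdot> B \<cdot> f \<cdot> e)) w))"

definition rinv_ty where
  "rinv_ty = pi univ (\<lambda>A. pi univ (\<lambda>B. Rinv (Path A B) (Equiv A B) (toequiv A B)))"

text \<open>\<open>w\<close> is split because \<open>equivtoid\<close> computes only on pairs and
  \<Sigma> has no judgemental \<eta>. On a pair the claim is \<open>eop\<close> for the structure
  that \<open>H\<close> provides.\<close>

lemma rinv_of_PIE: "inhabited (lift0 equivs_are_PIE \<rightarrow> equiv_of_PIE_ty \<rightarrow> rinv_ty)"
  by (rule inhabitedI[of "lam (lift0 equivs_are_PIE) (\<lambda>H. lam equiv_of_PIE_ty (\<lambda>eop.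
    lam univ (\<lambda>A. lam univ (\<lambda>B.
      pair (Rinv (Path A B) (Equiv A B) (toequiv A B)) (equivtoid H A \<cdot> B)
        (lam (Equiv A B) (\<lambda>w. split (Equiv A B)
          (\<lambda>w. path (Equiv A B) (to_equiv A B (equivtoid H A \<cdot> B \<cdot> w)) w)
          (\<lambda>f e. eop \<cdot> A \<cdot> B \<cdot> f \<cdot> (H \<cdot> A \<cdot> B \<cdot> f \<cdot> e) \<cdot> e) w))))))"]) code_simp

lemma univalence_of_inverses:
  "inhabited (linv_of_map_ty \<rightarrow> lift0 equivs_are_PIE \<rightarrow> rinv_ty \<rightarrow> lift0 isUnivalent)"
  by (rule inhabitedI[of "lam linv_of_map_ty (\<lambda>li. lam (lift0 equivs_are_PIE) (\<lambda>H. lam rinv_ty (\<lambda>ri.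
    lam univ (\<lambda>A. lam univ (\<lambda>B.
      pair (IsEquiv (Path A B) (Equiv A B) (toequiv A B))
        (li \<cdot> A \<cdot> equivtoid H A \<cdot> B) (ri \<cdot> A \<cdot> B))))))"]) code_simp

section \<open>Contractibility of the homotopies to the identity\<close>

definition Htpy_id :: "named \<Rightarrow> named" where
  "Htpy_id A = sig (A \<rightarrow> A) (\<lambda>g. pi A (\<lambda>a. path A (g \<cdot> a) a))"

definition htpy_refl :: "named \<Rightarrow> named" where
  "htpy_refl A = pair (Htpy_id A) (idfun A) (lam A (rfl A))"

definition htpy_contr_ty where
  "htpy_contr_ty = pi univ (\<lambda>A. pi (Htpy_id A) (\<lambda>n. path (Htpy_id A) (htpy_refl A) n))"

text \<open>\<open>linv\<close> and \<open>rinv\<close> of the identity both reduce to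
  \<open>Htpy_id A\<close>, and both components of \<open>id_isEquiv A\<close> to
  \<open>htpy_refl A\<close>. Contracting \<open>l\<close> and then \<open>r\<close> to
  \<open>htpy_refl A\<close> leaves reflexivity.\<close>

lemma loop_equiv: "inhabited (htpy_contr_ty \<rightarrow> loop_equiv_ty)"
  by (rule inhabitedI[of "lam htpy_contr_ty (\<lambda>contr.
    lam univ (\<lambda>A. lam (IsEquiv A A (idfun A)) (\<lambda>e.
      split (IsEquiv A A (idfun A))
        (\<lambda>e. path (Equiv A A) (idequiv A) (pair (Equiv A A) (idfun A) e))
        (\<lambda>l r. path_ind (Htpy_id A) (htpy_refl A)
          (\<lambda>l _. path (Equiv A A) (idequiv A)
            (pair (Equiv A A) (idfun A) (pair (IsEquiv A A (idfun A)) l r)))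
          (path_ind (Htpy_id A) (htpy_refl A)
            (\<lambda>r _. path (Equiv A A) (idequiv A)
              (pair (Equiv A A) (idfun A) (pair (IsEquiv A A (idfun A)) (htpy_refl A) r)))
            (rfl (Equiv A A) (idequiv A)) r (contr \<cdot> A \<cdot> r))
          l (contr \<cdot> A \<cdot> l)) e)))"]) code_simp

text \<open>
  Contractibility of the fibres of postcomposition with \<open>f\<close>, phrased as an induction principle. For
  \<open>f = id\<close> it is path induction, by \<open>\<eta>\<close>.
\<close>

definition Postcomp_ind :: "named \<Rightarrow> named \<Rightarrow> named \<Rightarrow> named" where
  "Postcomp_ind X Y f = pi univ (\<lambda>Z. pi (Z \<rightarrow> X) (\<lambda>u.
     pi (pi (Z \<rightarrow> X) (\<lambda>v. path (Z \<rightarrow> Y) (compose Z f u) (compose Z f v) \<rightarrow> univ)) (\<lambda>D.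
       D \<cdot> u \<cdot> rfl (Z \<rightarrow> Y) (compose Z f u) \<rightarrow>
       pi (Z \<rightarrow> X) (\<lambda>v. pi (path (Z \<rightarrow> Y) (compose Z f u) (compose Z f v)) (\<lambda>q. D \<cdot> v \<cdot> q)))))"

definition postcomp_ind_ty where
  "postcomp_ind_ty = pi univ (\<lambda>X. pi univ (\<lambda>Y. pi (X \<rightarrow> Y) (\<lambda>f.
     IsPIE X Y f \<rightarrow> Postcomp_ind X Y f)))"

text \<open>\<open>f\<close> is replaced first by \<open>to_fun X Y p\<close> and then by the
  identity, with the whole of \<open>Postcomp_ind\<close> as motive. It quantifies over \<U>, which
  is permitted because \<open>tm_J\<close> asks only for a type.\<close>

lemma postcomp_ind: "inhabited (inverse_ty \<rightarrow> postcomp_ind_ty)"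
  by (rule inhabitedI[of "lam inverse_ty (\<lambda>inv.
    lam univ (\<lambda>X. lam univ (\<lambda>Y. lam (X \<rightarrow> Y) (\<lambda>f. lam (IsPIE X Y f) (\<lambda>z.
      split (IsPIE X Y f) (\<lambda>_. Postcomp_ind X Y f)
        (\<lambda>p q. path_ind (X \<rightarrow> Y) (to_fun X Y p) (\<lambda>f _. Postcomp_ind X Y f)
          (path_ind univ X (\<lambda>Y p. Postcomp_ind X Y (to_fun X Y p))
            (lam univ (\<lambda>Z. lam (Z \<rightarrow> X) (\<lambda>u. lam (pi (Z \<rightarrow> X) (\<lambda>v. path (Z \<rightarrow> X) u v \<rightarrow> univ)) (\<lambda>D.
              lam (D \<cdot> u \<cdot> rfl (Z \<rightarrow> X) u) (\<lambda>d. lam (Z \<rightarrow> X) (\<lambda>v. lam (path (Z \<rightarrow> X) u v) (\<lambda>q.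
                path_ind (Z \<rightarrow> X) u (\<lambda>v q. D \<cdot> v \<cdot> q) d v q)))))))
            Y p)
          f (inv \<cdot> (X \<rightarrow> Y) \<cdot> f \<cdot> to_fun X Y p \<cdot> q)) z)))))"]) code_simp

section \<open>The path space and its target map\<close>

definition Paths_to :: "named \<Rightarrow> named \<Rightarrow> named" where
  "Paths_to A a = sig A (\<lambda>x. path A x a)"

text \<open>With the target as first component, \<open>target\<close> is a first projection, and a
  family of paths from \<open>g \<cdot> a\<close> to \<open>a\<close> gives a section of it.\<close>

definition Paths :: "named \<Rightarrow> named" where
  "Paths A = sig A (Paths_to A)"

definition mk_path :: "named \<Rightarrow> named \<Rightarrow> named \<Rightarrow> named \<Rightarrow> named" where
  "mk_path A a x q = pair (Paths A) a (pair (Paths_to A a) x q)"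

definition split_path ::
  "named \<Rightarrow> (named \<Rightarrow> named) \<Rightarrow> (named \<Rightarrow> named \<Rightarrow> named \<Rightarrow> named) \<Rightarrow> named \<Rightarrow> named" where
  "split_path A C g s = split (Paths A) C
     (\<lambda>a y. split (Paths_to A a) (\<lambda>y. C (pair (Paths A) a y)) (g a) y) s"

definition target :: "named \<Rightarrow> named \<Rightarrow> named" where
  "target A s = proj1 (Paths A) A s"

definition source :: "named \<Rightarrow> named \<Rightarrow> named" where
  "source A s = split_path A (\<lambda>_. A) (\<lambda>_ x _. x) s"

definition path_of :: "named \<Rightarrow> named \<Rightarrow> named" where
  "path_of A s = split_path A (\<lambda>s. path A (source A s) (target A s)) (\<lambda>_ _ q. q) s"

definition targets :: "named \<Rightarrow> named" where
  "targets A = lam (Paths A) (target A)"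

definition const_paths :: "named \<Rightarrow> named" where
  "const_paths A = lam A (\<lambda>a. mk_path A a a (rfl A a))"

definition targets_equiv_ty where
  "targets_equiv_ty = pi univ (\<lambda>A. IsEquiv (Paths A) A (targets A))"

text \<open>The constant paths are inverse on both sides. The target of a constant path reduces to
  its point, which settles the right inverse; for the left one, path induction moves the target to
  the source.\<close>

lemma targets_equiv: "inhabited targets_equiv_ty"
  by (rule inhabitedI[of "lam univ (\<lambda>A. pair (IsEquiv (Paths A) A (targets A))
    (pair (Linv (Paths A) A (targets A)) (const_paths A)
      (lam (Paths A) (\<lambda>s. split_path A (\<lambda>s. path (Paths A) (const_paths A \<cdot> target A s) s)
        (\<lambda>a x q. path_ind A x (\<lambda>a q. path (Paths A) (const_paths A \<cdot> a) (mk_path A a x q))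
          (rfl (Paths A) (const_paths A \<cdot> x)) a q) s)))
    (pair (Rinv (Paths A) A (targets A)) (const_paths A) (lam A (rfl A))))"]) code_simp

text \<open>
  A lift \<open>u\<close> of \<open>id\<close> along \<open>targets A\<close> gives homotopies with targets \<open>targets A \<circ> u\<close>, which are moved
  back to \<open>id\<close> along \<open>q\<close>. For the lift built from \<open>(g, \<eta>)\<close>, with \<open>q\<close> reflexivity, the result is
  judgementally \<open>(g, \<eta>)\<close>.
\<close>

definition htpy_of_lift :: "named \<Rightarrow> named \<Rightarrow> named \<Rightarrow> named" where
  "htpy_of_lift A u q =
     path_ind (A \<rightarrow> A) (idfun A)
       (\<lambda>y _. sig (A \<rightarrow> A) (\<lambda>g. pi A (\<lambda>a. path A (g \<cdot> a) (y \<cdot> a))) \<rightarrow> Htpy_id A)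
       (idfun (Htpy_id A)) (compose A (targets A) u) q \<cdot>
     pair (sig (A \<rightarrow> A) (\<lambda>g. pi A (\<lambda>a. path A (g \<cdot> a) (target A (u \<cdot> a)))))
       (lam A (\<lambda>a. source A (u \<cdot> a))) (lam A (\<lambda>a. path_of A (u \<cdot> a)))"

text \<open>\<open>ind\<close> is applied to \<open>targets A\<close>, from the lift
  \<open>const_paths A\<close> to the lift built from (g, \<eta>). Both composites reduce to the
  identity, so reflexivity joins them. The motive compares \<open>htpy_refl A\<close> with the
  homotopy read off from the lift: it holds by reflexivity at the first lift and is the claim at the
  second.\<close>

lemma htpy_contr:
  "inhabited (postcomp_ind_ty \<rightarrow> targets_equiv_ty \<rightarrow> lift0 equivs_are_PIE \<rightarrow> htpy_contr_ty)"
  by (rule inhabitedI[of "lam postcomp_ind_ty (\<lambda>ind. lam targets_equiv_ty (\<lambda>te.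
    lam (lift0 equivs_are_PIE) (\<lambda>H. lam univ (\<lambda>A. lam (Htpy_id A) (\<lambda>n.
      split (Htpy_id A) (\<lambda>n. path (Htpy_id A) (htpy_refl A) n)
        (\<lambda>g \<eta>. ind \<cdot> Paths A \<cdot> A \<cdot> targets A \<cdot> (H \<cdot> Paths A \<cdot> A \<cdot> targets A \<cdot> (te \<cdot> A)) \<cdot>
          A \<cdot> const_paths A \<cdot>
          lam (A \<rightarrow> Paths A) (\<lambda>u. lam (path (A \<rightarrow> A) (idfun A) (compose A (targets A) u)) (\<lambda>q.
            path (Htpy_id A) (htpy_refl A) (htpy_of_lift A u q))) \<cdot>
          rfl (Htpy_id A) (htpy_refl A) \<cdot>
          lam A (\<lambda>a. mk_path A a (g \<cdot> a) (\<eta> \<cdot> a)) \<cdot> rfl (A \<rightarrow> A) (idfun A)) n)))))"]) code_simp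

theorem theorem2p45:
  shows "(\<exists>t. [] \<turnstile> t \<^bold>: arr isUnivalent equivs_are_PIE) \<and>
         (\<exists>t. [] \<turnstile> t \<^bold>: arr equivs_are_PIE isUnivalent)"
proof
  show "\<exists>t. [] \<turnstile> t \<^bold>: arr isUnivalent equivs_are_PIE"
    using inhabited_mp[OF PIE_of_univalence underlying]
    by (simp add: inhabited_def lift2_def lift0_def)
next
  let ?H = "lift0 equivs_are_PIE"
  \<comment> \<open>From here on each result stays under the hypothesis \<open>?H\<close>, while
    closed auxiliary results are supplied by \<open>inhabited_mp\<close>.\<close>
  have "inhabited (?H \<rightarrow> htpy_contr_ty)"
    by (rule inhabited_mp[OF inhabited_mp[OF htpy_contr inhabited_mp[OF postcomp_ind inverse]] targets_equiv])
  then have "inhabited (?H \<rightarrow> equiv_of_path_ty)"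
    by (rule inhabited_comp[OF equiv_of_path inhabited_comp[OF loop_equiv]])
  then have "inhabited (?H \<rightarrow> rinv_ty)"
    by (rule inhabited_mp_under[OF rinv_of_PIE inhabited_comp[OF inhabited_mp[OF equiv_of_PIE inverse]]])
  then have "inhabited (?H \<rightarrow> lift0 isUnivalent)"
    by (rule inhabited_mp_under[OF
          inhabited_mp[OF univalence_of_inverses inhabited_mp[OF linv_of_map path_diff_self]]])
  then show "\<exists>t. [] \<turnstile> t \<^bold>: arr equivs_are_PIE isUnivalent"
    by (simp add: inhabited_def lift2_def lift0_def)
qed

end
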